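(* Fix $\mathcal S$, $\mathcal A$, $\mathcal R$, and consider the PTS and the PTSC they determine. (1) If $\Gamma\vdash_{\mathsf{PTS}}t:T$ then $\mathcal A(\Gamma)\vdash\mathcal A(t):\mathcal A(T)$. (2) If, for each $i=1,\dots,n$, $\Gamma\vdash_{\mathsf{PTS}}t_i:T_i\{x_1:=t_1\}\cdots\{x_{i-1}:=t_{i-1}\}$, and $\mathcal A(\Gamma)\vdash\mathcal A(\Pi x_1^{T_1}.\cdots\Pi x_n^{T_n}.T):s$ for some sort $s$, then $\mathcal A(\Gamma);\mathcal A(\Pi x_1^{T_1}.\cdots\Pi x_n^{T_n}.T)\vdash\mathcal A(t_1)\cdot(\cdots(\mathcal A(t_n)\cdot[\,])\cdots):\mathcal A(T\{x_1:=t_1\}\cdots\{x_n:=t_n\})$. (3) If $\Gamma\ \mathsf{wf}$ in the PTS then $\mathcal A(\Gamma)\ \mathsf{wf}$ in the PTSC.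
   Context: Ground PTSC syntax: given sorts $\mathcal S$ and variables, terms $M ::= \Pi x^{A}.B \mid \lambda x^{A}.M \mid s \mid x\,l \mid M\,l \mid \langle N/x\rangle_A M$ and lists $l ::= [\,] \mid M\cdot l \mid l @ l' \mid \langle N/x\rangle_A l$ ($\langle N/x\rangle_A$ explicit substitution binding $x$; $\Pi,\lambda$ bind $x$). Reduction $\to$ is the contextual closure of: $(\lambda x^A.M)(N\cdot l)\to(\langle N/x\rangle_A M)\,l$; $M\,[\,]\to M$; $(x\,l)\,l'\to x\,(l@l')$; $(M\,l)\,l'\to M\,(l@l')$; $(M\cdot l')@l\to M\cdot(l'@l)$; $[\,]@l\to l$; $(l@l')@l''\to l@(l'@l'')$; $l@[\,]\to l$; $\langle P/y\rangle_G(\lambda x^A.M)\to\lambda x^{\langle P/y\rangle_G A}.\langle P/y\rangle_G M$; $\langle P/y\rangle_G(y\,l)\to P\,(\langle P/y\rangle_G l)$; $\langle P/y\rangle_G(x\,l)\to x\,(\langle P/y\rangle_G l)$ ($x\ne y$); $\langle P/y\rangle_G(M\,l)\to(\langle P/y\rangle_G M)(\langle P/y\rangle_G l)$; $\langle P/y\rangle_G(\Pi x^A.B)\to\Pi x^{\langle P/y\rangle_G A}.\langle P/y\rangle_G B$; $\langle P/y\rangle_G s\to s$; $\langle P/y\rangle_G[\,]\to[\,]$; $\langle P/y\rangle_G(M\cdot l)\to(\langle P/y\rangle_G M)\cdot(\langle P/y\rangle_G l)$; $\langle P/y\rangle_G(l@l')\to(\langle P/y\rangle_G l)@(\langle P/y\rangle_G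 l')$; $\leftrightarrow^*$ is the induced equivalence. PTSC typing (parameters $\mathcal A\subseteq\mathcal S^2$, $\mathcal R\subseteq\mathcal S^3$): environments are lists of $(x:A)$; $\langle P/x\rangle_A\Delta$ applies the substitution to every type of $\Delta$; $\Gamma\sqsubseteq\Delta$ means each $(x:A)\in\Gamma$ has some $(x:B)\in\Delta$ with $A\leftrightarrow^*B$. Rules: $\emptyset\ \mathsf{wf}$; $\Gamma\vdash A:s$, $x\notin\mathrm{dom}\,\Gamma\Rightarrow\Gamma,(x:A)\ \mathsf{wf}$; $\Gamma\ \mathsf{wf}$, $(s,s')\in\mathcal A\Rightarrow\Gamma\vdash s:s'$; $\Gamma\vdash A:s_1$, $\Gamma,(x:A)\vdash B:s_2$, $(s_1,s_2,s_3)\in\mathcal R\Rightarrow\Gamma\vdash\Pi x^A.B:s_3$; $\Gamma\vdash\Pi x^A.B:s$, $\Gamma,(x:A)\vdash M:B\Rightarrow\Gamma\vdash\lambda x^A.M:\Pi x^A.B$; $\Gamma;A\vdash l:B$, $(x:A)\in\Gamma\Rightarrow\Gamma\vdash x\,l:B$; $\Gamma\vdash A:s\Rightarrow\Gamma;A\vdash[\,]:A$; $\Gamma\vdash M:A$, $\Gamma\vdash B:s$, $A\leftrightarrow^*B\Rightarrow\Gamma\vdash M:B$; $\Gamma\vdash\Pi x^A.B:s$, $\Gamma\vdash M:A$, $\Gamma;\langle M/x\rangle_A B\vdash l:C\Rightarrow\Gamma;\Pi x^A.B\vdash M\cdot l:C$; $\Gamma;C\vdash l:A$, $\Gamma\vdash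 B:s$, $A\leftrightarrow^*B\Rightarrow\Gamma;C\vdash l:B$; $\Gamma;A\vdash l:C$, $\Gamma\vdash B:s$, $A\leftrightarrow^*B\Rightarrow\Gamma;B\vdash l:C$; $\Gamma;C\vdash l':A$, $\Gamma;A\vdash l:B\Rightarrow\Gamma;C\vdash l'@l:B$; $\Gamma\vdash P:A$, $\Gamma,(x:A),\Delta;B\vdash l:C$, $\Gamma,\langle P/x\rangle_A\Delta\sqsubseteq\Delta'$, $\Delta'\ \mathsf{wf}\Rightarrow\Delta';\langle P/x\rangle_A B\vdash\langle P/x\rangle_A l:\langle P/x\rangle_A C$; $\Gamma\vdash M:A$, $\Gamma;A\vdash l:B\Rightarrow\Gamma\vdash M\,l:B$; $\Gamma\vdash P:A$, $\Gamma,(x:A),\Delta\vdash M:C$, $\Gamma,\langle P/x\rangle_A\Delta\sqsubseteq\Delta'$, $\Delta'\ \mathsf{wf}\Rightarrow\Delta'\vdash\langle P/x\rangle_A M:C'$ with $C'=C$ if $C\in\mathcal S$, else $C'=\langle P/x\rangle_A C$. PTS: terms $t,u,T,U ::= x\mid s\mid\Pi x^T.t\mid\lambda x^T.t\mid t\,u$, $\beta$-reduction $(\lambda x^v.t)u\to t\{x:=u\}$, $\leftrightarrow_\beta^*$ its equivalence. PTS typing rules (same $\mathcal S,\mathcal A,\mathcal R$): $\emptyset\ \mathsf{wf}$; $\Gamma\vdash_{\mathsf{PTS}}T:s$, $x\notin\mathrm{dom}\,\Gamma\Rightarrow\Gamma,(x:T)\ \mathsf{wf}$; $\Gamma\ \mathsf{wf}$,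 $(x:T)\in\Gamma\Rightarrow\Gamma\vdash_{\mathsf{PTS}}x:T$; $\Gamma\ \mathsf{wf}$, $(s,s')\in\mathcal A\Rightarrow\Gamma\vdash_{\mathsf{PTS}}s:s'$; $\Gamma\vdash_{\mathsf{PTS}}U:s_1$, $\Gamma,(x:U)\vdash_{\mathsf{PTS}}T:s_2$, $(s_1,s_2,s_3)\in\mathcal R\Rightarrow\Gamma\vdash_{\mathsf{PTS}}\Pi x^U.T:s_3$; $\Gamma\vdash_{\mathsf{PTS}}\Pi x^U.T:s$, $\Gamma,(x:U)\vdash_{\mathsf{PTS}}t:T\Rightarrow\Gamma\vdash_{\mathsf{PTS}}\lambda x^U.t:\Pi x^U.T$; $\Gamma\vdash_{\mathsf{PTS}}t:\Pi x^U.T$, $\Gamma\vdash_{\mathsf{PTS}}u:U\Rightarrow\Gamma\vdash_{\mathsf{PTS}}t\,u:T\{x:=u\}$; $\Gamma\vdash_{\mathsf{PTS}}t:U$, $\Gamma\vdash_{\mathsf{PTS}}V:s$, $U\leftrightarrow_\beta^*V\Rightarrow\Gamma\vdash_{\mathsf{PTS}}t:V$. Translation $\mathcal A$ (PTS to PTSC): $\mathcal A(s)=s$, $\mathcal A(\Pi x^T.U)=\Pi x^{\mathcal A(T)}.\mathcal A(U)$, $\mathcal A(\lambda x^T.t)=\lambda x^{\mathcal A(T)}.\mathcal A(t)$, $\mathcal A(t)=\mathcal A_{[\,]}(t)$ if $t$ is a variable or application; $\mathcal A_l(t\,u)=\mathcal A_{\mathcal A(u)\cdot l}(t)$, $\mathcal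 A_l(x)=x\,l$, $\mathcal A_l(t)=\mathcal A(t)\,l$ otherwise. On environments: $\mathcal A(\emptyset)=\emptyset$, $\mathcal A(\Gamma,(x:T))=\mathcal A(\Gamma),(x:\mathcal A(T))$. *)

theory Defs
  imports Main
begin

text \<open>
  Terms are taken up to renaming of bound variables, with the natural numbers as the set of variable
  names.  Alpha-equivalence classes are represented by de Bruijn terms: under \<open>k\<close> binders
  the index \<open>i < k\<close> is bound and the index \<open>k + n\<close> stands for the free variable named \<open>n\<close>.
  Hence de Bruijn terms are exactly the alpha-equivalence classes, without junk.  Named binders are
  given by the operations
  \<open>ppi x T U\<close>, \<open>plam x T t\<close>, \<open>cpi x A B\<close>, \<open>clam x A M\<close>, \<open>csub N x A M\<close>, \<open>lsub N x A l\<close>, which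
  abstract the named variable \<open>x\<close> (see \<open>plam_alpha\<close>, \<open>pbody_named\<close> and their neighbours below);
  environments and all reduction and typing rules are stated
  with names.
\<close>

type_synonym name = nat

text \<open>The renaming that abstracts the name \<open>x\<close>, and the extension of a renaming under a binder.\<close>

definition bindr :: "name \<Rightarrow> nat \<Rightarrow> nat" where
  "bindr x = (\<lambda>y. if y = x then 0 else Suc y)"

definition upr :: "(nat \<Rightarrow> nat) \<Rightarrow> nat \<Rightarrow> nat" where
  "upr \<rho> = (\<lambda>n. case n of 0 \<Rightarrow> 0 | Suc m \<Rightarrow> Suc (\<rho> m))"


section \<open>Pure type systems\<close>

datatype 's pterm =
    PVar nat
  | PSort 's
  | PPi "'s pterm" "'s pterm"
  | PLam "'s pterm" "'s pterm"
  | PApp "'s pterm" "'s pterm"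

primrec pren :: "(nat \<Rightarrow> nat) \<Rightarrow> 's pterm \<Rightarrow> 's pterm" where
  "pren \<rho> (PVar x) = PVar (\<rho> x)"
| "pren \<rho> (PSort s) = PSort s"
| "pren \<rho> (PPi T U) = PPi (pren \<rho> T) (pren (upr \<rho>) U)"
| "pren \<rho> (PLam T t) = PLam (pren \<rho> T) (pren (upr \<rho>) t)"
| "pren \<rho> (PApp t u) = PApp (pren \<rho> t) (pren \<rho> u)"

primrec pfv :: "'s pterm \<Rightarrow> name set" where
  "pfv (PVar x) = {x}"
| "pfv (PSort s) = {}"
| "pfv (PPi T U) = pfv T \<union> {n. Suc n \<in> pfv U}"
| "pfv (PLam T t) = pfv T \<union> {n. Suc n \<in> pfv t}"
| "pfv (PApp t u) = pfv t \<union> pfv u"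

definition ups :: "(nat \<Rightarrow> 's pterm) \<Rightarrow> nat \<Rightarrow> 's pterm" where
  "ups \<sigma> = (\<lambda>n. case n of 0 \<Rightarrow> PVar 0 | Suc m \<Rightarrow> pren Suc (\<sigma> m))"

primrec pinst :: "(nat \<Rightarrow> 's pterm) \<Rightarrow> 's pterm \<Rightarrow> 's pterm" where
  "pinst \<sigma> (PVar x) = \<sigma> x"
| "pinst \<sigma> (PSort s) = PSort s"
| "pinst \<sigma> (PPi T U) = PPi (pinst \<sigma> T) (pinst (ups \<sigma>) U)"
| "pinst \<sigma> (PLam T t) = PLam (pinst \<sigma> T) (pinst (ups \<sigma>) t)"
| "pinst \<sigma> (PApp t u) = PApp (pinst \<sigma> t) (pinst \<sigma> u)"

text \<open>\<open>psubst x u t\<close> is $t\{x:=u\}$.\<close>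

definition psubst :: "name \<Rightarrow> 's pterm \<Rightarrow> 's pterm \<Rightarrow> 's pterm" where
  "psubst x u t = pinst (PVar(x := u)) t"

definition ppi :: "name \<Rightarrow> 's pterm \<Rightarrow> 's pterm \<Rightarrow> 's pterm" where
  "ppi x T U = PPi T (pren (bindr x) U)"

definition plam :: "name \<Rightarrow> 's pterm \<Rightarrow> 's pterm \<Rightarrow> 's pterm" where
  "plam x T t = PLam T (pren (bindr x) t)"

inductive pbeta :: "'s pterm \<Rightarrow> 's pterm \<Rightarrow> bool" where
  beta: "pbeta (PApp (plam x v t) u) (psubst x u t)"
| pi1: "pbeta T T' \<Longrightarrow> pbeta (ppi x T U) (ppi x T' U)"
| pi2: "pbeta U U' \<Longrightarrow> pbeta (ppi x T U) (ppi x T U')"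
| lam1: "pbeta T T' \<Longrightarrow> pbeta (plam x T t) (plam x T' t)"
| lam2: "pbeta t t' \<Longrightarrow> pbeta (plam x T t) (plam x T t')"
| app1: "pbeta t t' \<Longrightarrow> pbeta (PApp t u) (PApp t' u)"
| app2: "pbeta u u' \<Longrightarrow> pbeta (PApp t u) (PApp t u')"

definition pconv :: "'s pterm \<Rightarrow> 's pterm \<Rightarrow> bool" where
  "pconv = equivclp pbeta"

text \<open>Environments are extended on the right: $\Gamma,(x:T)$ is \<open>\<Gamma> @ [(x, T)]\<close>.\<close>

type_synonym 's penv = "(name \<times> 's pterm) list"

inductive pwf :: "('s \<times> 's) set \<Rightarrow> ('s \<times> 's \<times> 's) set \<Rightarrow> 's penv \<Rightarrow> bool"
  and pty :: "('s \<times> 's) set \<Rightarrow> ('s \<times> 's \<times> 's) set \<Rightarrow> 's penv \<Rightarrow> 's pterm \<Rightarrow> 's pterm \<Rightarrow> bool"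
  for Ax :: "('s \<times> 's) set" and Rl :: "('s \<times> 's \<times> 's) set"
where
  pwf_empty: "pwf Ax Rl []"
| pwf_ext: "pty Ax Rl \<Gamma> T (PSort s) \<Longrightarrow> x \<notin> fst ` set \<Gamma> \<Longrightarrow> pwf Ax Rl (\<Gamma> @ [(x, T)])"
| pty_var: "pwf Ax Rl \<Gamma> \<Longrightarrow> (x, T) \<in> set \<Gamma> \<Longrightarrow> pty Ax Rl \<Gamma> (PVar x) T"
| pty_sort: "pwf Ax Rl \<Gamma> \<Longrightarrow> (s, s') \<in> Ax \<Longrightarrow> pty Ax Rl \<Gamma> (PSort s) (PSort s')"
| pty_pi: "pty Ax Rl \<Gamma> U (PSort s1) \<Longrightarrow> pty Ax Rl (\<Gamma> @ [(x, U)]) T (PSort s2) \<Longrightarrow>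
    (s1, s2, s3) \<in> Rl \<Longrightarrow> pty Ax Rl \<Gamma> (ppi x U T) (PSort s3)"
| pty_lam: "pty Ax Rl \<Gamma> (ppi x U T) (PSort s) \<Longrightarrow> pty Ax Rl (\<Gamma> @ [(x, U)]) t T \<Longrightarrow>
    pty Ax Rl \<Gamma> (plam x U t) (ppi x U T)"
| pty_app: "pty Ax Rl \<Gamma> t (ppi x U T) \<Longrightarrow> pty Ax Rl \<Gamma> u U \<Longrightarrow>
    pty Ax Rl \<Gamma> (PApp t u) (psubst x u T)"
| pty_conv: "pty Ax Rl \<Gamma> t U \<Longrightarrow> pty Ax Rl \<Gamma> V (PSort s) \<Longrightarrow> pconv U V \<Longrightarrow> pty Ax Rl \<Gamma> t V"

text \<open>
  \<open>ppis [(x\<^sub>1,T\<^sub>1),\<dots>,(x\<^sub>n,T\<^sub>n)] T\<close> is $\Pi x_1^{T_1}.\cdots\Pi x_n^{T_n}.T$ and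
  \<open>psubsts [(x\<^sub>1,t\<^sub>1),\<dots>,(x\<^sub>n,t\<^sub>n)] T\<close> is $T\{x_1:=t_1\}\cdots\{x_n:=t_n\}$, performed from
  left to right.
\<close>

definition ppis :: "(name \<times> 's pterm) list \<Rightarrow> 's pterm \<Rightarrow> 's pterm" where
  "ppis xTs T = foldr (\<lambda>(x, U) V. ppi x U V) xTs T"

definition psubsts :: "(name \<times> 's pterm) list \<Rightarrow> 's pterm \<Rightarrow> 's pterm" where
  "psubsts xts T = fold (\<lambda>(x, u) V. psubst x u V) xts T"


section \<open>Pure type sequent calculi\<close>

text \<open>\<open>CVar x l\<close> is $x\,l$, \<open>CApp M l\<close> is $M\,l$, \<open>LCat l l'\<close> is $l @ l'$; \<open>CSub N A M\<close> and
  \<open>LSub N A l\<close> are explicit substitutions, binding in their last argument only.\<close>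

datatype 's cterm =
    CPi "'s cterm" "'s cterm"
  | CLam "'s cterm" "'s cterm"
  | CSort 's
  | CVar nat "'s clist"
  | CApp "'s cterm" "'s clist"
  | CSub "'s cterm" "'s cterm" "'s cterm"
and 's clist =
    LNil
  | LCons "'s cterm" "'s clist"
  | LCat "'s clist" "'s clist"
  | LSub "'s cterm" "'s cterm" "'s clist"

primrec cren :: "(nat \<Rightarrow> nat) \<Rightarrow> 's cterm \<Rightarrow> 's cterm"
  and lren :: "(nat \<Rightarrow> nat) \<Rightarrow> 's clist \<Rightarrow> 's clist" where
  "cren \<rho> (CPi A B) = CPi (cren \<rho> A) (cren (upr \<rho>) B)"
| "cren \<rho> (CLam A M) = CLam (cren \<rho> A) (cren (upr \<rho>) M)"
| "cren \<rho> (CSort s) = CSort s"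
| "cren \<rho> (CVar x l) = CVar (\<rho> x) (lren \<rho> l)"
| "cren \<rho> (CApp M l) = CApp (cren \<rho> M) (lren \<rho> l)"
| "cren \<rho> (CSub N A M) = CSub (cren \<rho> N) (cren \<rho> A) (cren (upr \<rho>) M)"
| "lren \<rho> LNil = LNil"
| "lren \<rho> (LCons M l) = LCons (cren \<rho> M) (lren \<rho> l)"
| "lren \<rho> (LCat l l') = LCat (lren \<rho> l) (lren \<rho> l')"
| "lren \<rho> (LSub N A l) = LSub (cren \<rho> N) (cren \<rho> A) (lren (upr \<rho>) l)"

primrec cfv :: "'s cterm \<Rightarrow> name set" and lfv :: "'s clist \<Rightarrow> name set" where
  "cfv (CPi A B) = cfv A \<union> {n. Suc n \<in> cfv B}"
| "cfv (CLam A M) = cfv A \<union> {n. Suc n \<in> cfv M}"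
| "cfv (CSort s) = {}"
| "cfv (CVar x l) = insert x (lfv l)"
| "cfv (CApp M l) = cfv M \<union> lfv l"
| "cfv (CSub N A M) = cfv N \<union> cfv A \<union> {n. Suc n \<in> cfv M}"
| "lfv LNil = {}"
| "lfv (LCons M l) = cfv M \<union> lfv l"
| "lfv (LCat l l') = lfv l \<union> lfv l'"
| "lfv (LSub N A l) = cfv N \<union> cfv A \<union> {n. Suc n \<in> lfv l}"

definition cpi :: "name \<Rightarrow> 's cterm \<Rightarrow> 's cterm \<Rightarrow> 's cterm" where
  "cpi x A B = CPi A (cren (bindr x) B)"

definition clam :: "name \<Rightarrow> 's cterm \<Rightarrow> 's cterm \<Rightarrow> 's cterm" where
  "clam x A M = CLam A (cren (bindr x) M)"

text \<open>\<open>csub N x A M\<close> is $\langle N/x\rangle_A M$ and \<open>lsub N x A l\<close> is $\langle N/x\rangle_A l$.\<close>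

definition csub :: "'s cterm \<Rightarrow> name \<Rightarrow> 's cterm \<Rightarrow> 's cterm \<Rightarrow> 's cterm" where
  "csub N x A M = CSub N A (cren (bindr x) M)"

definition lsub :: "'s cterm \<Rightarrow> name \<Rightarrow> 's cterm \<Rightarrow> 's clist \<Rightarrow> 's clist" where
  "lsub N x A l = LSub N A (lren (bindr x) l)"

text \<open>
  The freshness conditions on \<open>x\<close> in \<open>s_lam\<close> and \<open>s_pi\<close> are those under which pushing the
  substitution under the binder is capture-free; a bound name satisfying them always exists.
\<close>

inductive cred :: "'s cterm \<Rightarrow> 's cterm \<Rightarrow> bool"
  and lred :: "'s clist \<Rightarrow> 's clist \<Rightarrow> bool"
where
  b_beta: "cred (CApp (clam x A M) (LCons N l)) (CApp (csub N x A M) l)"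
| b_nil: "cred (CApp M LNil) M"
| b_var: "cred (CApp (CVar x l) l') (CVar x (LCat l l'))"
| b_app: "cred (CApp (CApp M l) l') (CApp M (LCat l l'))"
| a_cons: "lred (LCat (LCons M l') l) (LCons M (LCat l' l))"
| a_nil: "lred (LCat LNil l) l"
| a_cat: "lred (LCat (LCat l l') l'') (LCat l (LCat l' l''))"
| a_nil_right: "lred (LCat l LNil) l"
| s_lam: "x \<noteq> y \<Longrightarrow> x \<notin> cfv P \<Longrightarrow> x \<notin> cfv G \<Longrightarrow>
    cred (csub P y G (clam x A M)) (clam x (csub P y G A) (csub P y G M))"
| s_var_eq: "cred (csub P y G (CVar y l)) (CApp P (lsub P y G l))"
| s_var_neq: "x \<noteq> y \<Longrightarrow> cred (csub P y G (CVar x l)) (CVar x (lsub P y G l))"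
| s_app: "cred (csub P y G (CApp M l)) (CApp (csub P y G M) (lsub P y G l))"
| s_pi: "x \<noteq> y \<Longrightarrow> x \<notin> cfv P \<Longrightarrow> x \<notin> cfv G \<Longrightarrow>
    cred (csub P y G (cpi x A B)) (cpi x (csub P y G A) (csub P y G B))"
| s_sort: "cred (csub P y G (CSort s)) (CSort s)"
| s_nil: "lred (lsub P y G LNil) LNil"
| s_cons: "lred (lsub P y G (LCons M l)) (LCons (csub P y G M) (lsub P y G l))"
| s_cat: "lred (lsub P y G (LCat l l')) (LCat (lsub P y G l) (lsub P y G l'))"
| c_pi1: "cred A A' \<Longrightarrow> cred (cpi x A B) (cpi x A' B)"
| c_pi2: "cred B B' \<Longrightarrow> cred (cpi x A B) (cpi x A B')"
| c_lam1: "cred A A' \<Longrightarrow> cred (clam x A M) (clam x A' M)"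
| c_lam2: "cred M M' \<Longrightarrow> cred (clam x A M) (clam x A M')"
| c_var: "lred l l' \<Longrightarrow> cred (CVar x l) (CVar x l')"
| c_app1: "cred M M' \<Longrightarrow> cred (CApp M l) (CApp M' l)"
| c_app2: "lred l l' \<Longrightarrow> cred (CApp M l) (CApp M l')"
| c_sub1: "cred N N' \<Longrightarrow> cred (csub N x A M) (csub N' x A M)"
| c_sub2: "cred A A' \<Longrightarrow> cred (csub N x A M) (csub N x A' M)"
| c_sub3: "cred M M' \<Longrightarrow> cred (csub N x A M) (csub N x A M')"
| c_cons1: "cred M M' \<Longrightarrow> lred (LCons M l) (LCons M' l)"
| c_cons2: "lred l l' \<Longrightarrow> lred (LCons M l) (LCons M l')"
| c_cat1: "lred l k \<Longrightarrow> lred (LCat l l') (LCat k l')"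
| c_cat2: "lred l' k \<Longrightarrow> lred (LCat l l') (LCat l k)"
| c_lsub1: "cred N N' \<Longrightarrow> lred (lsub N x A l) (lsub N' x A l)"
| c_lsub2: "cred A A' \<Longrightarrow> lred (lsub N x A l) (lsub N x A' l)"
| c_lsub3: "lred l l' \<Longrightarrow> lred (lsub N x A l) (lsub N x A l')"

definition cconv :: "'s cterm \<Rightarrow> 's cterm \<Rightarrow> bool" where
  "cconv = equivclp cred"

type_synonym 's cenv = "(name \<times> 's cterm) list"

definition esub :: "'s cterm \<Rightarrow> name \<Rightarrow> 's cterm \<Rightarrow> 's cenv \<Rightarrow> 's cenv" where
  "esub P x A \<Delta> = map (\<lambda>(y, B). (y, csub P x A B)) \<Delta>"

definition subenv :: "'s cenv \<Rightarrow> 's cenv \<Rightarrow> bool" where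
  "subenv \<Gamma> \<Delta> \<longleftrightarrow> (\<forall>(x, A) \<in> set \<Gamma>. \<exists>B. (x, B) \<in> set \<Delta> \<and> cconv A B)"

text \<open>\<open>cty Ax Rl \<Gamma> M A\<close> is $\Gamma\vdash M:A$ and \<open>lty Ax Rl \<Gamma> A l B\<close> is $\Gamma;A\vdash l:B$.\<close>

inductive cwf :: "('s \<times> 's) set \<Rightarrow> ('s \<times> 's \<times> 's) set \<Rightarrow> 's cenv \<Rightarrow> bool"
  and cty :: "('s \<times> 's) set \<Rightarrow> ('s \<times> 's \<times> 's) set \<Rightarrow> 's cenv \<Rightarrow> 's cterm \<Rightarrow> 's cterm \<Rightarrow> bool"
  and lty :: "('s \<times> 's) set \<Rightarrow> ('s \<times> 's \<times> 's) set \<Rightarrow>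
    's cenv \<Rightarrow> 's cterm \<Rightarrow> 's clist \<Rightarrow> 's cterm \<Rightarrow> bool"
  for Ax :: "('s \<times> 's) set" and Rl :: "('s \<times> 's \<times> 's) set"
where
  cwf_empty: "cwf Ax Rl []"
| cwf_ext: "cty Ax Rl \<Gamma> A (CSort s) \<Longrightarrow> x \<notin> fst ` set \<Gamma> \<Longrightarrow> cwf Ax Rl (\<Gamma> @ [(x, A)])"
| cty_sort: "cwf Ax Rl \<Gamma> \<Longrightarrow> (s, s') \<in> Ax \<Longrightarrow> cty Ax Rl \<Gamma> (CSort s) (CSort s')"
| cty_pi: "cty Ax Rl \<Gamma> A (CSort s1) \<Longrightarrow> cty Ax Rl (\<Gamma> @ [(x, A)]) B (CSort s2) \<Longrightarrow>
    (s1, s2, s3) \<in> Rl \<Longrightarrow> cty Ax Rl \<Gamma> (cpi x A B) (CSort s3)"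
| cty_lam: "cty Ax Rl \<Gamma> (cpi x A B) (CSort s) \<Longrightarrow> cty Ax Rl (\<Gamma> @ [(x, A)]) M B \<Longrightarrow>
    cty Ax Rl \<Gamma> (clam x A M) (cpi x A B)"
| cty_var: "lty Ax Rl \<Gamma> A l B \<Longrightarrow> (x, A) \<in> set \<Gamma> \<Longrightarrow> cty Ax Rl \<Gamma> (CVar x l) B"
| lty_nil: "cty Ax Rl \<Gamma> A (CSort s) \<Longrightarrow> lty Ax Rl \<Gamma> A LNil A"
| cty_conv: "cty Ax Rl \<Gamma> M A \<Longrightarrow> cty Ax Rl \<Gamma> B (CSort s) \<Longrightarrow> cconv A B \<Longrightarrow> cty Ax Rl \<Gamma> M B"
| lty_cons: "cty Ax Rl \<Gamma> (cpi x A B) (CSort s) \<Longrightarrow> cty Ax Rl \<Gamma> M A \<Longrightarrow>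
    lty Ax Rl \<Gamma> (csub M x A B) l C \<Longrightarrow> lty Ax Rl \<Gamma> (cpi x A B) (LCons M l) C"
| lty_conv_right: "lty Ax Rl \<Gamma> C l A \<Longrightarrow> cty Ax Rl \<Gamma> B (CSort s) \<Longrightarrow> cconv A B \<Longrightarrow>
    lty Ax Rl \<Gamma> C l B"
| lty_conv_left: "lty Ax Rl \<Gamma> A l C \<Longrightarrow> cty Ax Rl \<Gamma> B (CSort s) \<Longrightarrow> cconv A B \<Longrightarrow>
    lty Ax Rl \<Gamma> B l C"
| lty_cat: "lty Ax Rl \<Gamma> C l' A \<Longrightarrow> lty Ax Rl \<Gamma> A l B \<Longrightarrow> lty Ax Rl \<Gamma> C (LCat l' l) B"
| lty_sub: "cty Ax Rl \<Gamma> P A \<Longrightarrow> lty Ax Rl (\<Gamma> @ [(x, A)] @ \<Delta>) B l C \<Longrightarrow>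
    subenv (\<Gamma> @ esub P x A \<Delta>) \<Delta>' \<Longrightarrow> cwf Ax Rl \<Delta>' \<Longrightarrow>
    lty Ax Rl \<Delta>' (csub P x A B) (lsub P x A l) (csub P x A C)"
| cty_app: "cty Ax Rl \<Gamma> M A \<Longrightarrow> lty Ax Rl \<Gamma> A l B \<Longrightarrow> cty Ax Rl \<Gamma> (CApp M l) B"
| cty_sub: "cty Ax Rl \<Gamma> P A \<Longrightarrow> cty Ax Rl (\<Gamma> @ [(x, A)] @ \<Delta>) M C \<Longrightarrow>
    subenv (\<Gamma> @ esub P x A \<Delta>) \<Delta>' \<Longrightarrow> cwf Ax Rl \<Delta>' \<Longrightarrow>
    C' = (if C \<in> range CSort then C else csub P x A C) \<Longrightarrow>
    cty Ax Rl \<Delta>' (csub P x A M) C'"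


section \<open>The translation\<close>

text \<open>
  \<open>tr\<close> is $\mathcal A(\cdot)$ and \<open>trl l\<close> is $\mathcal A_l(\cdot)$.  The translation is compatible with
  renaming, so the clauses for \<open>PPi\<close> and \<open>PLam\<close>, which act on the representation of the body, yield
  the named clauses (\<open>tr_ppi\<close> and \<open>tr_plam\<close> below).
\<close>

fun neutral :: "'s pterm \<Rightarrow> bool" where
  "neutral (PVar x) = True"
| "neutral (PApp t u) = True"
| "neutral _ = False"

function (sequential) tr :: "'s pterm \<Rightarrow> 's cterm"
  and trl :: "'s clist \<Rightarrow> 's pterm \<Rightarrow> 's cterm" where
  "tr (PSort s) = CSort s"
| "tr (PPi T U) = CPi (tr T) (tr U)"
| "tr (PLam T t) = CLam (tr T) (tr t)"
| "tr t = trl LNil t"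
| "trl l (PApp t u) = trl (LCons (tr u) l) t"
| "trl l (PVar x) = CVar x l"
| "trl l t = CApp (tr t) l"
  by pat_completeness auto
termination
  by (relation "measure (\<lambda>i. case i of
        Inl t \<Rightarrow> 2 * size t + (if neutral t then 1 else 0)
      | Inr (l, t) \<Rightarrow> 2 * size t + (if neutral t then 0 else 1))") auto

definition trenv :: "'s penv \<Rightarrow> 's cenv" where
  "trenv \<Gamma> = map (\<lambda>(x, T). (x, tr T)) \<Gamma>"

definition trargs :: "'s pterm list \<Rightarrow> 's clist" where
  "trargs ts = foldr (\<lambda>t l. LCons (tr t) l) ts LNil"


section \<open>The named clauses\<close>

lemma tr_trl_pren:
  "tr (pren \<rho> t) = cren \<rho> (tr t)"
  "trl (lren \<rho> l) (pren \<rho> t) = cren \<rho> (trl l t)"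
proof (induction t and l t arbitrary: \<rho> and \<rho> rule: tr_trl.induct)
  case ("4_1" x)
  then show ?case using "4_1"[of \<rho>] by simp
next
  case ("4_2" t u)
  then show ?case using "4_2"[of \<rho>] by simp
next
  case (5 l t u)
  show ?case using 5(1)[of \<rho>] 5(2)[of \<rho>] by simp
qed auto

lemma tr_ppi: "tr (ppi x T U) = cpi x (tr T) (tr U)"
  by (simp add: ppi_def cpi_def tr_trl_pren)

lemma tr_plam: "tr (plam x T t) = clam x (tr T) (tr t)"
  by (simp add: plam_def clam_def tr_trl_pren)

lemma pren_cong: "(\<And>n. n \<in> pfv t \<Longrightarrow> \<rho> n = \<rho>' n) \<Longrightarrow> pren \<rho> t = pren \<rho>' t"
proof (induction t arbitrary: \<rho> \<rho>')
  case (PPi T U)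
  show ?case using PPi.prems by (auto simp: upr_def split: nat.splits intro!: PPi.IH)
next
  case (PLam T t)
  show ?case using PLam.prems by (auto simp: upr_def split: nat.splits intro!: PLam.IH)
next
  case (PApp t u)
  show ?case using PApp.prems by (auto intro!: PApp.IH)
qed auto

lemma cren_lren_cong:
  fixes M :: "'s cterm" and l :: "'s clist"
  shows
  "(\<And>n. n \<in> cfv M \<Longrightarrow> \<rho> n = \<rho>' n) \<Longrightarrow> cren \<rho> M = cren \<rho>' M"
  "(\<And>n. n \<in> lfv l \<Longrightarrow> \<rho> n = \<rho>' n) \<Longrightarrow> lren \<rho> l = lren \<rho>' l"
proof (induction M and l arbitrary: \<rho> \<rho>' and \<rho> \<rho>' rule: cterm.induct clist.induct)
  case (CPi A B)
  show ?case using CPi.prems by (auto simp: upr_def split: nat.splits intro!: CPi.IH)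
next
  case (CLam A M)
  show ?case using CLam.prems by (auto simp: upr_def split: nat.splits intro!: CLam.IH)
next
  case (CVar x l)
  show ?case using CVar.prems by (auto intro!: CVar.IH)
next
  case (CApp M l)
  show ?case using CApp.prems by (auto intro!: CApp.IH)
next
  case (CSub N A M)
  show ?case using CSub.prems by (auto simp: upr_def split: nat.splits intro!: CSub.IH)
next
  case (LCons M l)
  show ?case using LCons.prems by (auto intro!: LCons.IH)
next
  case (LCat l l')
  show ?case using LCat.prems by (auto intro!: LCat.IH)
next
  case (LSub N A l)
  show ?case using LSub.prems by (auto simp: upr_def split: nat.splits intro!: LSub.IH)
qed auto

lemma upr_comp: "upr \<rho> \<circ> upr \<rho>' = upr (\<rho> \<circ> \<rho>')"
  by (auto simp: upr_def fun_eq_iff split: nat.splits)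

lemma pren_pren: "pren \<rho> (pren \<rho>' t) = pren (\<rho> \<circ> \<rho>') t"
  by (induction t arbitrary: \<rho> \<rho>') (simp_all add: upr_comp)

lemma cren_lren_comp:
  fixes M :: "'s cterm" and l :: "'s clist"
  shows
  "cren \<rho> (cren \<rho>' M) = cren (\<rho> \<circ> \<rho>') M"
  "lren \<rho> (lren \<rho>' l) = lren (\<rho> \<circ> \<rho>') l"
  by (induction M and l arbitrary: \<rho> \<rho>' and \<rho> \<rho>' rule: cterm.induct clist.induct) (simp_all add: upr_comp)

text \<open>Bound names can be changed.\<close>

lemma plam_alpha:
  assumes "y \<notin> pfv t"
  shows "plam y T (pren (id(x := y)) t) = plam x T t"
  using assms by (auto simp: plam_def pren_pren bindr_def intro!: pren_cong)

lemma clam_alpha: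
  assumes "y \<notin> cfv M"
  shows "clam y A (cren (id(x := y)) M) = clam x A M"
  using assms by (auto simp: clam_def cren_lren_comp bindr_def intro!: cren_lren_cong)

lemma csub_alpha:
  assumes "y \<notin> cfv M"
  shows "csub N y A (cren (id(x := y)) M) = csub N x A M"
  using assms by (auto simp: csub_def cren_lren_comp bindr_def intro!: cren_lren_cong)

text \<open>Every body of a binder arises by abstracting an arbitrarily fresh name.\<close>

lemma finite_Suc_vimage: "finite X \<Longrightarrow> finite {n. Suc n \<in> X}"
  using finite_vimageI[of X Suc] by (simp add: vimage_def)

lemma finite_pfv: "finite (pfv t)"
  by (induction t) (auto simp: finite_Suc_vimage)

lemma finite_cfv_lfv:
  fixes M :: "'s cterm" and l :: "'s clist"
  shows "finite (cfv M)" "finite (lfv l)"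
  by (induction M and l rule: cterm.induct clist.induct) (auto simp: finite_Suc_vimage)

lemma upr_id: "upr id = id"
  by (auto simp: upr_def fun_eq_iff split: nat.splits)

lemma pren_id: "pren id t = t"
  by (induction t) (simp_all add: upr_id[unfolded id_def] id_def)

lemma cren_lren_id:
  fixes M :: "'s cterm" and l :: "'s clist"
  shows "cren id M = M" "lren id l = l"
  by (induction M and l rule: cterm.induct clist.induct) (simp_all add: upr_id[unfolded id_def] id_def)

lemma fresh_name:
  fixes X Y :: "nat set"
  assumes "finite X" "finite Y"
  obtains x where "x \<notin> X" "Suc x \<notin> Y"
proof -
  have "finite (X \<union> {n. Suc n \<in> Y})"
    using assms by (simp add: finite_Suc_vimage)
  then obtain x where "x \<notin> X \<union> {n. Suc n \<in> Y}"
    using ex_new_if_finite infinite_UNIV_nat by blast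
  then show ?thesis using that by auto
qed

lemma bindr_inverse:
  "Suc x \<noteq> n \<Longrightarrow> (bindr x \<circ> (\<lambda>m. case m of 0 \<Rightarrow> x | Suc k \<Rightarrow> k)) n = id n"
  by (auto simp: bindr_def split: nat.splits)

lemma pbody_named:
  assumes "finite X"
  obtains x t where "x \<notin> X" "b = pren (bindr x) t"
proof -
  obtain x where x: "x \<notin> X" "Suc x \<notin> pfv b"
    using fresh_name[OF assms finite_pfv] .
  have "pren (bindr x) (pren (\<lambda>m. case m of 0 \<Rightarrow> x | Suc k \<Rightarrow> k) b) = pren id b"
    unfolding pren_pren using x by (intro pren_cong bindr_inverse) auto
  then show ?thesis using that x by (metis pren_id)
qed

lemma cbody_named:
  assumes "finite X"
  obtains x M where "x \<notin> X" "b = cren (bindr x) M"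
proof -
  obtain x where x: "x \<notin> X" "Suc x \<notin> cfv b"
    using fresh_name[OF assms finite_cfv_lfv(1)] .
  have "cren (bindr x) (cren (\<lambda>m. case m of 0 \<Rightarrow> x | Suc k \<Rightarrow> k) b) = cren id b"
    unfolding cren_lren_comp using x by (intro cren_lren_cong bindr_inverse) auto
  then show ?thesis using that x by (metis cren_lren_id(1))
qed

lemma lbody_named:
  assumes "finite X"
  obtains x l where "x \<notin> X" "b = lren (bindr x) l"
proof -
  obtain x where x: "x \<notin> X" "Suc x \<notin> lfv b"
    using fresh_name[OF assms finite_cfv_lfv(2)] .
  have "lren (bindr x) (lren (\<lambda>m. case m of 0 \<Rightarrow> x | Suc k \<Rightarrow> k) b) = lren id b"
    unfolding cren_lren_comp using x by (intro cren_lren_cong bindr_inverse) auto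
  then show ?thesis using that x by (metis cren_lren_id(2))
qed

text \<open>Substitution satisfies the usual capture-avoiding equations.\<close>

lemma pinst_cong: "(\<And>n. n \<in> pfv t \<Longrightarrow> \<sigma> n = \<sigma>' n) \<Longrightarrow> pinst \<sigma> t = pinst \<sigma>' t"
proof (induction t arbitrary: \<sigma> \<sigma>')
  case (PPi T U)
  show ?case using PPi.prems by (auto simp: ups_def split: nat.splits intro!: PPi.IH)
next
  case (PLam T t)
  show ?case using PLam.prems by (auto simp: ups_def split: nat.splits intro!: PLam.IH)
next
  case (PApp t u)
  show ?case using PApp.prems by (auto intro!: PApp.IH)
qed auto

lemma ups_upr: "ups \<sigma> \<circ> upr \<rho> = ups (\<sigma> \<circ> \<rho>)"
  by (auto simp: ups_def upr_def fun_eq_iff split: nat.splits)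

lemma pinst_pren: "pinst \<sigma> (pren \<rho> t) = pinst (\<sigma> \<circ> \<rho>) t"
  by (induction t arbitrary: \<sigma> \<rho>) (simp_all add: ups_upr)

lemma upr_ups: "pren (upr \<rho>) \<circ> ups \<sigma> = ups (pren \<rho> \<circ> \<sigma>)"
  by (auto simp: ups_def upr_def fun_eq_iff pren_pren o_def split: nat.splits)

lemma pren_pinst: "pren \<rho> (pinst \<sigma> t) = pinst (pren \<rho> \<circ> \<sigma>) t"
  by (induction t arbitrary: \<sigma> \<rho>) (simp_all add: upr_ups)

lemma psubst_bind:
  assumes "x \<noteq> y" "x \<notin> pfv u"
  shows "pinst (ups (PVar(y := u))) (pren (bindr x) t) = pren (bindr x) (psubst y u t)"
proof -
  have "pren Suc u = pren (bindr x) u"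
    using assms by (intro pren_cong) (auto simp: bindr_def)
  then show ?thesis
    using assms
    by (auto simp: psubst_def pinst_pren pren_pinst ups_def bindr_def intro!: pinst_cong)
qed

lemma psubst_plam:
  assumes "x \<noteq> y" "x \<notin> pfv u"
  shows "psubst y u (plam x T t) = plam x (psubst y u T) (psubst y u t)"
  using psubst_bind[OF assms, of t] by (simp add: plam_def psubst_def)

lemma psubst_ppi:
  assumes "x \<noteq> y" "x \<notin> pfv u"
  shows "psubst y u (ppi x T U) = ppi x (psubst y u T) (psubst y u U)"
  using psubst_bind[OF assms, of U] by (simp add: ppi_def psubst_def)

end

theory Submission
  imports Defs "HOL-Combinatorics.Transposition"
begin

text \<open>
  The rule for applications needs the translation of $T\{x:=u\}$ to be typable, whereas PTSC
  derivations provide only the explicit substitution $\langle\mathcal A(u)/x\rangle\mathcal A(T)$.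
  Neither confluence nor full subject reduction is needed for this: by induction on PTSC derivations, a
  derivation of a translated term $\mathcal A(t)$ under a declaration of $x$ yields one of
  $\mathcal A(t\{x:=u\})$, where the types, which need not be translations, keep the explicit
  substitution and are adjusted by conversion.  The conversions needed there hold because every PTSC
  term is convertible to a translated one without new free variables, and on translated terms the
  explicit substitution is convertible to the implicit one.  An application is then typed by
  extending the argument list at the head of its spine.
\<close>

section \<open>Renaming and named induction\<close>

text \<open>Explicit substitutions enter even the derivations of translated terms:
  \<open>lty_cons\<close> types the rest of an argument list from \<open>csub M x A B\<close>. So an
  induction on derivations must admit arbitrary PTSC types, and only the subject of the judgement
  can be restricted. The restriction pays off because a translated term contains neither explicit
  substitutions nor concatenations, which empties the cases of \<open>cty_sub\<close>,
  \<open>lty_sub\<close> and \<open>lty_cat\<close>. No reduction rule moves one explicit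
  substitution through another, hence facts such as the erasure of a substitution for a fresh name
  are not computations on arbitrary terms. They are obtained on translated terms and carried back,
  and this is why the passage to translated terms must not create free variables. The other obstacle
  is naming. The rules name their binders, while substitution and weakening lead to an arbitrary
  larger environment in which such a name may already be declared. Names are therefore swapped by
  transpositions, which are injective and so preserve typing, unlike the replacement of one name by
  another.\<close>

definition unbindr :: "name \<Rightarrow> nat \<Rightarrow> nat" where
  "unbindr x = (\<lambda>m. case m of 0 \<Rightarrow> x | Suc k \<Rightarrow> k)"

lemma unbindr_bindr: "unbindr x \<circ> bindr x = id"
  by (auto simp: unbindr_def bindr_def fun_eq_iff)

lemma cren_unbindr_bindr: "cren (unbindr x) (cren (bindr x) M) = M"
  by (simp add: cren_lren_comp unbindr_bindr cren_lren_id)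

text \<open>\<open>Suc x\<close> is the only index that \<open>bindr x\<close> misses, hence the
  only obstruction to undoing \<open>unbindr x\<close> on a body.\<close>

lemma pren_bindr_unbindr:
  assumes "Suc x \<notin> pfv t"
  shows "pren (bindr x) (pren (unbindr x) t) = t"
proof -
  have "pren (bindr x) (pren (unbindr x) t) = pren id t"
    unfolding pren_pren unbindr_def using assms by (intro pren_cong bindr_inverse) auto
  then show ?thesis by (simp add: pren_id)
qed

lemma cren_bindr_unbindr:
  assumes "Suc x \<notin> cfv M"
  shows "cren (bindr x) (cren (unbindr x) M) = M"
proof -
  have "cren (bindr x) (cren (unbindr x) M) = cren id M"
    unfolding cren_lren_comp unbindr_def using assms by (intro cren_lren_cong bindr_inverse) auto
  then show ?thesis by (simp add: cren_lren_id)
qed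

lemma lren_bindr_unbindr:
  assumes "Suc x \<notin> lfv l"
  shows "lren (bindr x) (lren (unbindr x) l) = l"
proof -
  have "lren (bindr x) (lren (unbindr x) l) = lren id l"
    unfolding cren_lren_comp unbindr_def using assms by (intro cren_lren_cong bindr_inverse) auto
  then show ?thesis by (simp add: cren_lren_id)
qed

lemma upr_vimage: "{n. Suc n \<in> upr \<rho> ` S} = \<rho> ` {n. Suc n \<in> S}"
proof -
  have "Suc n = upr \<rho> m \<longleftrightarrow> (\<exists>k. m = Suc k \<and> n = \<rho> k)" for n m
    by (cases m) (simp_all add: upr_def)
  then show ?thesis by (auto simp: image_iff)
qed

lemma pfv_pren: "pfv (pren \<rho> t) = \<rho> ` pfv t"
  by (induction t arbitrary: \<rho>) (simp_all add: upr_vimage image_Un)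

lemma cfv_lfv_ren:
  fixes M :: "'s cterm" and l :: "'s clist"
  shows "cfv (cren \<rho> M) = \<rho> ` cfv M" "lfv (lren \<rho> l) = \<rho> ` lfv l"
  by (induction M and l arbitrary: \<rho> and \<rho> rule: cterm.induct clist.induct)
    (simp_all add: upr_vimage image_Un)

lemma bindr_vimage: "{n. Suc n \<in> bindr x ` S} = S - {x}"
proof -
  have "Suc n = bindr x m \<longleftrightarrow> m \<noteq> x \<and> n = m" for n m
    by (auto simp: bindr_def)
  then show ?thesis by (auto simp: image_iff)
qed

lemma cfv_cpi: "cfv (cpi x A B) = cfv A \<union> (cfv B - {x})"
  by (simp add: cpi_def cfv_lfv_ren bindr_vimage)

lemma cfv_clam: "cfv (clam x A M) = cfv A \<union> (cfv M - {x})"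
  by (simp add: clam_def cfv_lfv_ren bindr_vimage)

lemma cfv_csub: "cfv (csub N x A M) = cfv N \<union> cfv A \<union> (cfv M - {x})"
  by (simp add: csub_def cfv_lfv_ren bindr_vimage)

lemma lfv_lsub: "lfv (lsub N x A l) = cfv N \<union> cfv A \<union> (lfv l - {x})"
  by (simp add: lsub_def cfv_lfv_ren bindr_vimage)

lemma pfv_ppi: "pfv (ppi x T U) = pfv T \<union> (pfv U - {x})"
  by (simp add: ppi_def pfv_pren bindr_vimage)

lemma pfv_plam: "pfv (plam x T t) = pfv T \<union> (pfv t - {x})"
  by (simp add: plam_def pfv_pren bindr_vimage)

text \<open>Injectivity prevents \<open>\<rho>\<close> from sending another name to
  \<open>\<rho> x\<close>, where the abstraction would capture it.\<close>

lemma upr_bindr: "inj \<rho> \<Longrightarrow> upr \<rho> \<circ> bindr x = bindr (\<rho> x) \<circ> \<rho>"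
  by (auto simp: upr_def bindr_def fun_eq_iff inj_eq)

lemma cren_named:
  assumes "inj \<rho>"
  shows "cren \<rho> (cpi x A B) = cpi (\<rho> x) (cren \<rho> A) (cren \<rho> B)"
    and "cren \<rho> (clam x A B) = clam (\<rho> x) (cren \<rho> A) (cren \<rho> B)"
    and "cren \<rho> (csub N x A B) = csub (cren \<rho> N) (\<rho> x) (cren \<rho> A) (cren \<rho> B)"
    and "lren \<rho> (lsub N x A l) = lsub (cren \<rho> N) (\<rho> x) (cren \<rho> A) (lren \<rho> l)"
  using assms by (simp_all add: cpi_def clam_def csub_def lsub_def cren_lren_comp upr_bindr)

lemma cpi_alpha:
  assumes "y \<notin> cfv B"
  shows "cpi y A (cren (id(x := y)) B) = cpi x A B"
  using assms by (auto simp: cpi_def cren_lren_comp bindr_def intro!: cren_lren_cong)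

lemma ppi_alpha:
  assumes "y \<notin> pfv U"
  shows "ppi y T (pren (id(x := y)) U) = ppi x T U"
  using assms by (auto simp: ppi_def pren_pren bindr_def intro!: pren_cong)

text \<open>The claim is proved for all renamings of \<open>t\<close>: naming a bound index turns
  the body into a renamed copy, which is not a subterm, so a plain structural hypothesis would not
  apply to it. The finite set \<open>X\<close> implements the variable convention.\<close>

lemma pterm_named_induct [consumes 1, case_names PVar PSort ppi plam PApp]:
  fixes t :: "'s pterm"
  assumes "finite X"
    and var: "\<And>x. P (PVar x)"
    and sort: "\<And>s. P (PSort s)"
    and pi: "\<And>x T U. x \<notin> X \<Longrightarrow> P T \<Longrightarrow> P U \<Longrightarrow> P (ppi x T U)"
    and lam: "\<And>x T t. x \<notin> X \<Longrightarrow> P T \<Longrightarrow> P t \<Longrightarrow> P (plam x T t)"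
    and app: "\<And>t u. P t \<Longrightarrow> P u \<Longrightarrow> P (PApp t u)"
  shows "P t"
proof -
  have "P (pren \<rho> t)" for \<rho>
  proof (induction t arbitrary: \<rho>)
    case (PPi T U)
    obtain x where x: "x \<notin> X" "Suc x \<notin> pfv (pren (upr \<rho>) U)"
      using fresh_name[OF \<open>finite X\<close> finite_pfv] .
    have "pren \<rho> (PPi T U) = ppi x (pren \<rho> T) (pren (unbindr x \<circ> upr \<rho>) U)"
      using pren_bindr_unbindr[OF x(2)] by (simp add: ppi_def pren_pren)
    then show ?case using pi[OF x(1) PPi] by simp
  next
    case (PLam T U)
    obtain x where x: "x \<notin> X" "Suc x \<notin> pfv (pren (upr \<rho>) U)"
      using fresh_name[OF \<open>finite X\<close> finite_pfv] .
    have "pren \<rho> (PLam T U) = plam x (pren \<rho> T) (pren (unbindr x \<circ> upr \<rho>) U)"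
      using pren_bindr_unbindr[OF x(2)] by (simp add: plam_def pren_pren)
    then show ?case using lam[OF x(1) PLam] by simp
  qed (simp_all add: var sort app)
  from this[of id] show ?thesis by (simp add: pren_id)
qed

text \<open>The generalisation over renamings is as for PTS terms. Binders are not kept away from a
  set of names, because \<open>ex_tr_trargs\<close> treats every constructor by a fact valid for any
  binder name.\<close>

lemma cterm_clist_named_induct
  [case_names cpi clam CSort CVar CApp csub LNil LCons LCat lsub]:
  fixes M :: "'s cterm" and l :: "'s clist"
  assumes pi: "\<And>x A B. P A \<Longrightarrow> P B \<Longrightarrow> P (cpi x A B)"
    and lam: "\<And>x A M. P A \<Longrightarrow> P M \<Longrightarrow> P (clam x A M)"
    and sort: "\<And>s. P (CSort s)"
    and var: "\<And>x l. Q l \<Longrightarrow> P (CVar x l)"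
    and app: "\<And>M l. P M \<Longrightarrow> Q l \<Longrightarrow> P (CApp M l)"
    and sub: "\<And>N x A M. P N \<Longrightarrow> P A \<Longrightarrow> P M \<Longrightarrow> P (csub N x A M)"
    and nil: "Q LNil"
    and cons: "\<And>M l. P M \<Longrightarrow> Q l \<Longrightarrow> Q (LCons M l)"
    and cat: "\<And>l l'. Q l \<Longrightarrow> Q l' \<Longrightarrow> Q (LCat l l')"
    and lsub: "\<And>N x A l. P N \<Longrightarrow> P A \<Longrightarrow> Q l \<Longrightarrow> Q (lsub N x A l)"
  shows "P M" "Q l"
proof -
  have "P (cren \<rho> M)" "Q (lren \<rho> l)" for \<rho>
  proof (induction M and l arbitrary: \<rho> and \<rho> rule: cterm.induct clist.induct)
    case (CPi A B)
    obtain x where x: "Suc x \<notin> cfv (cren (upr \<rho>) B)"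
      using fresh_name[OF finite.emptyI finite_cfv_lfv(1)] .
    have "cren \<rho> (CPi A B) = cpi x (cren \<rho> A) (cren (unbindr x \<circ> upr \<rho>) B)"
      using cren_bindr_unbindr[OF x] by (simp add: cpi_def cren_lren_comp)
    then show ?case using pi[OF CPi] by simp
  next
    case (CLam A B)
    obtain x where x: "Suc x \<notin> cfv (cren (upr \<rho>) B)"
      using fresh_name[OF finite.emptyI finite_cfv_lfv(1)] .
    have "cren \<rho> (CLam A B) = clam x (cren \<rho> A) (cren (unbindr x \<circ> upr \<rho>) B)"
      using cren_bindr_unbindr[OF x] by (simp add: clam_def cren_lren_comp)
    then show ?case using lam[OF CLam] by simp
  next
    case (CSub N A B)
    obtain x where x: "Suc x \<notin> cfv (cren (upr \<rho>) B)"
      using fresh_name[OF finite.emptyI finite_cfv_lfv(1)] .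
    have "cren \<rho> (CSub N A B) = csub (cren \<rho> N) x (cren \<rho> A) (cren (unbindr x \<circ> upr \<rho>) B)"
      using cren_bindr_unbindr[OF x] by (simp add: csub_def cren_lren_comp)
    then show ?case using sub[OF CSub] by simp
  next
    case (LSub N A B)
    obtain x where x: "Suc x \<notin> lfv (lren (upr \<rho>) B)"
      using fresh_name[OF finite.emptyI finite_cfv_lfv(2)] .
    have "lren \<rho> (LSub N A B) = lsub (cren \<rho> N) x (cren \<rho> A) (lren (unbindr x \<circ> upr \<rho>) B)"
      using lren_bindr_unbindr[OF x] by (simp add: lsub_def cren_lren_comp)
    then show ?case using lsub[OF LSub] by simp
  qed (simp_all add: sort var app nil cons cat)
  from this[of id] show "P M" "Q l" by (simp_all add: cren_lren_id)
qed

section \<open>Conversion\<close>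

definition lconv :: "'s clist \<Rightarrow> 's clist \<Rightarrow> bool" where
  "lconv = equivclp lred"

lemma equivclp_map:
  assumes "equivclp R x y" and "\<And>x y. R x y \<Longrightarrow> S (f x) (f y)"
  shows "equivclp S (f x) (f y)"
  using assms(1)
proof (induction rule: equivclp_induct)
  case (step y z)
  then show ?case using assms(2) by (metis equivclp_into_equivclp)
qed simp

lemma cconv_refl [simp]: "cconv M M"
  and cconv_red: "cred M N \<Longrightarrow> cconv M N"
  and cconv_sym: "cconv M N \<Longrightarrow> cconv N M"
  and cconv_trans [trans]: "cconv L M \<Longrightarrow> cconv M N \<Longrightarrow> cconv L N"
  unfolding cconv_def by (auto intro: equivclp_sym equivclp_trans r_into_equivclp)

lemma lconv_refl [simp]: "lconv l l"
  and lconv_red: "lred l k \<Longrightarrow> lconv l k"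
  and lconv_trans [trans]: "lconv j k \<Longrightarrow> lconv k l \<Longrightarrow> lconv j l"
  unfolding lconv_def by (auto intro: equivclp_sym equivclp_trans r_into_equivclp)

lemma cconv_cpi: "cconv A A' \<Longrightarrow> cconv B B' \<Longrightarrow> cconv (cpi x A B) (cpi x A' B')"
  by (rule cconv_trans[of _ "cpi x A' B"]; unfold cconv_def; erule equivclp_map; rule c_pi1 c_pi2)

lemma cconv_clam: "cconv A A' \<Longrightarrow> cconv M M' \<Longrightarrow> cconv (clam x A M) (clam x A' M')"
  by (rule cconv_trans[of _ "clam x A' M"]; unfold cconv_def; erule equivclp_map; rule c_lam1 c_lam2)

lemma cconv_CVar: "lconv l l' \<Longrightarrow> cconv (CVar x l) (CVar x l')"
  unfolding cconv_def lconv_def by (erule equivclp_map) (rule c_var)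

lemma cconv_CApp: "cconv M M' \<Longrightarrow> lconv l l' \<Longrightarrow> cconv (CApp M l) (CApp M' l')"
  by (rule cconv_trans[of _ "CApp M' l"]; unfold cconv_def lconv_def; erule equivclp_map;
      rule c_app1 c_app2)

lemma cconv_csub:
  assumes "cconv N N'" "cconv A A'" "cconv M M'"
  shows "cconv (csub N x A M) (csub N' x A' M')"
proof -
  have "cconv (csub N x A M) (csub N' x A M)"
    using assms(1) unfolding cconv_def by (rule equivclp_map) (rule c_sub1)
  also have "cconv \<dots> (csub N' x A' M)"
    using assms(2) unfolding cconv_def by (rule equivclp_map) (rule c_sub2)
  also have "cconv \<dots> (csub N' x A' M')"
    using assms(3) unfolding cconv_def by (rule equivclp_map) (rule c_sub3)
  finally show ?thesis .
qed

lemma lconv_LCons: "cconv M M' \<Longrightarrow> lconv l l' \<Longrightarrow> lconv (LCons M l) (LCons M' l')"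
  by (rule lconv_trans[of _ "LCons M' l"]; unfold cconv_def lconv_def; erule equivclp_map;
      rule c_cons1 c_cons2)

lemma lconv_LCat: "lconv k k' \<Longrightarrow> lconv l l' \<Longrightarrow> lconv (LCat k l) (LCat k' l')"
  by (rule lconv_trans[of _ "LCat k' l"]; unfold cconv_def lconv_def; erule equivclp_map;
      rule c_cat1 c_cat2)

lemma lconv_lsub:
  assumes "cconv N N'" "cconv A A'" "lconv l l'"
  shows "lconv (lsub N x A l) (lsub N' x A' l')"
proof -
  have "lconv (lsub N x A l) (lsub N' x A l)"
    using assms(1) unfolding cconv_def lconv_def by (rule equivclp_map) (rule c_lsub1)
  also have "lconv \<dots> (lsub N' x A' l)"
    using assms(2) unfolding cconv_def lconv_def by (rule equivclp_map) (rule c_lsub2)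
  also have "lconv \<dots> (lsub N' x A' l')"
    using assms(3) unfolding lconv_def by (rule equivclp_map) (rule c_lsub3)
  finally show ?thesis .
qed

text \<open>Besides commuting with binders, injectivity keeps \<open>x \<noteq> y\<close> and the
  freshness conditions of the substitution rules true after renaming.\<close>

lemma cred_lred_ren:
  fixes M N :: "'s cterm" and l k :: "'s clist"
  assumes "inj \<rho>"
  shows "cred M N \<Longrightarrow> cred (cren \<rho> M) (cren \<rho> N)"
    and "lred l k \<Longrightarrow> lred (lren \<rho> l) (lren \<rho> k)"
  by (induction rule: cred_lred.inducts)
    (simp_all add: cren_named[OF assms] cred_lred.intros cfv_lfv_ren inj_eq[OF assms]
      inj_image_mem_iff[OF assms])

lemma cconv_cren: "inj \<rho> \<Longrightarrow> cconv M N \<Longrightarrow> cconv (cren \<rho> M) (cren \<rho> N)"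
  unfolding cconv_def by (erule equivclp_map) (rule cred_lred_ren)

section \<open>The translation of substitution and conversion\<close>

lemma trl_LNil_neutral: "neutral t \<Longrightarrow> trl LNil t = tr t"
  by (cases t) auto

lemma trl_not_neutral: "\<not> neutral t \<Longrightarrow> trl l t = CApp (tr t) l"
  by (cases t) auto

lemma cconv_trl: "lconv l k \<Longrightarrow> cconv (trl l t) (trl k t)"
  by (induction t arbitrary: l k) (simp_all add: cconv_CVar cconv_CApp lconv_LCons)

text \<open>\<open>a_cons\<close> carries the concatenation past one argument of the spine at a
  time; the head is handled by \<open>b_var\<close> or \<open>b_app\<close>.\<close>

lemma CApp_trl: "cconv (CApp (trl k t) l) (trl (LCat k l) t)"
proof (induction t arbitrary: k)
  case (PApp t u)
  have "cconv (CApp (trl (LCons (tr u) k) t) l) (trl (LCat (LCons (tr u) k) l) t)"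
    by (rule PApp)
  also have "cconv \<dots> (trl (LCons (tr u) (LCat k l)) t)"
    by (intro cconv_trl lconv_red a_cons)
  finally show ?case by simp
qed (simp_all add: cconv_red b_var b_app)

lemma CApp_tr: "cconv (CApp (tr t) l) (trl l t)"
proof (cases "neutral t")
  case True
  have "cconv (CApp (trl LNil t) l) (trl (LCat LNil l) t)"
    by (rule CApp_trl)
  also have "cconv \<dots> (trl l t)"
    by (intro cconv_trl lconv_red a_nil)
  finally show ?thesis using True by (simp add: trl_LNil_neutral)
qed (simp add: trl_not_neutral)

lemma tr_trl_LNil: "cconv (trl LNil t) (tr t)"
  by (cases "neutral t") (auto simp: trl_LNil_neutral trl_not_neutral intro: cconv_red b_nil)

text \<open>A head variable meets its arguments only in the accumulator of \<open>trl\<close>, so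
  the induction also needs \<open>?Q\<close>, the claim for an arbitrary accumulator. For neutral
  terms \<open>?Q\<close> at \<open>LNil\<close> gives the claim for \<open>tr\<close>; for all
  others \<open>trl\<close> merely wraps \<open>tr\<close>, and the claim for \<open>tr\<close>
  gives \<open>?Q\<close>. The names avoided by binders are those that \<open>s_pi\<close>,
  \<open>s_lam\<close> and their implicit counterparts forbid.\<close>

lemma csub_tr:
  "cconv (csub (tr u) x G (tr t)) (tr (psubst x u t))"
proof -
  define P where "P = tr u"
  let ?Q = "\<lambda>t. \<forall>l. cconv (csub P x G (trl l t)) (trl (lsub P x G l) (psubst x u t))"
  have neut: "cconv (csub P x G (tr t)) (tr (psubst x u t))" if "?Q t" "neutral t" for t
  proof -
    have "cconv (csub P x G (trl LNil t)) (trl (lsub P x G LNil) (psubst x u t))"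
      using that by blast
    also have "cconv \<dots> (trl LNil (psubst x u t))"
      by (intro cconv_trl lconv_red s_nil)
    also have "cconv \<dots> (tr (psubst x u t))"
      by (rule tr_trl_LNil)
    finally show ?thesis using that by (simp add: trl_LNil_neutral)
  qed
  have nonneut: "?Q t" if "cconv (csub P x G (tr t)) (tr (psubst x u t))" "\<not> neutral t" for t
  proof
    fix l
    have "cconv (csub P x G (CApp (tr t) l)) (CApp (csub P x G (tr t)) (lsub P x G l))"
      by (intro cconv_red s_app)
    also have "cconv \<dots> (CApp (tr (psubst x u t)) (lsub P x G l))"
      using that by (intro cconv_CApp) auto
    also have "cconv \<dots> (trl (lsub P x G l) (psubst x u t))"
      by (rule CApp_tr)
    finally show "cconv (csub P x G (trl l t)) (trl (lsub P x G l) (psubst x u t))"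
      using that by (simp add: trl_not_neutral)
  qed
  have "finite ({x} \<union> pfv u \<union> cfv P \<union> cfv G)"
    by (simp add: finite_pfv finite_cfv_lfv)
  then have "cconv (csub P x G (tr t)) (tr (psubst x u t)) \<and> ?Q t"
  proof (induction t rule: pterm_named_induct)
    case (PVar y)
    have "?Q (PVar y)"
    proof
      fix l
      show "cconv (csub P x G (trl l (PVar y))) (trl (lsub P x G l) (psubst x u (PVar y)))"
      proof (cases "y = x")
        case True
        have "cconv (csub P x G (CVar x l)) (CApp (tr u) (lsub P x G l))"
          unfolding P_def by (intro cconv_red s_var_eq)
        also have "cconv \<dots> (trl (lsub P x G l) u)" by (rule CApp_tr)
        finally show ?thesis using True by (simp add: psubst_def)
      next
        case False
        then show ?thesis by (simp add: psubst_def cconv_red s_var_neq)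
      qed
    qed
    with neut[OF this] show ?case by simp
  next
    case (PSort s)
    have "cconv (csub P x G (tr (PSort s))) (tr (psubst x u (PSort s)))"
      by (simp add: psubst_def cconv_red s_sort)
    with nonneut[OF this] show ?case by simp
  next
    case (ppi y T U)
    then have y: "y \<noteq> x" "y \<notin> pfv u" "y \<notin> cfv P" "y \<notin> cfv G" by auto
    have "cconv (csub P x G (cpi y (tr T) (tr U))) (cpi y (csub P x G (tr T)) (csub P x G (tr U)))"
      using y by (intro cconv_red s_pi)
    also have "cconv \<dots> (cpi y (tr (psubst x u T)) (tr (psubst x u U)))"
      using ppi by (intro cconv_cpi) auto
    finally have "cconv (csub P x G (tr (ppi y T U))) (tr (psubst x u (ppi y T U)))"
      using y by (simp add: psubst_ppi tr_ppi)
    moreover have "\<not> neutral (ppi y T U)" by (simp add: ppi_def)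
    ultimately show ?case using nonneut by blast
  next
    case (plam y T U)
    then have y: "y \<noteq> x" "y \<notin> pfv u" "y \<notin> cfv P" "y \<notin> cfv G" by auto
    have "cconv (csub P x G (clam y (tr T) (tr U))) (clam y (csub P x G (tr T)) (csub P x G (tr U)))"
      using y by (intro cconv_red s_lam)
    also have "cconv \<dots> (clam y (tr (psubst x u T)) (tr (psubst x u U)))"
      using plam by (intro cconv_clam) auto
    finally have "cconv (csub P x G (tr (plam y T U))) (tr (psubst x u (plam y T U)))"
      using y by (simp add: psubst_plam tr_plam)
    moreover have "\<not> neutral (plam y T U)" by (simp add: plam_def)
    ultimately show ?case using nonneut by blast
  next
    case (PApp t v)
    have "?Q (PApp t v)"
    proof
      fix l
      have "cconv (csub P x G (trl (LCons (tr v) l) t))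
          (trl (lsub P x G (LCons (tr v) l)) (psubst x u t))"
        using PApp by blast
      also have "cconv \<dots> (trl (LCons (csub P x G (tr v)) (lsub P x G l)) (psubst x u t))"
        by (intro cconv_trl lconv_red s_cons)
      also have "cconv \<dots> (trl (LCons (tr (psubst x u v)) (lsub P x G l)) (psubst x u t))"
        using PApp by (intro cconv_trl lconv_LCons) auto
      finally show "cconv (csub P x G (trl l (PApp t v)))
          (trl (lsub P x G l) (psubst x u (PApp t v)))"
        by (simp add: psubst_def)
    qed
    with neut[OF this] show ?case by simp
  qed
  then show ?thesis by (simp add: P_def)
qed

lemma cconv_csub_tr:
  assumes "cconv N (tr u)" "cconv M (tr t)"
  shows "cconv (csub N x A M) (tr (psubst x u t))"
  by (rule cconv_trans[OF cconv_csub[OF assms(1) cconv_refl assms(2)] csub_tr])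

text \<open>A form of the translated application that does not depend on whether \<open>t\<close> is
  neutral, a property that beta steps inside \<open>t\<close> can change.\<close>

lemma cconv_tr_PApp: "cconv (tr (PApp t u)) (CApp (tr t) (LCons (tr u) LNil))"
  using CApp_tr[THEN cconv_sym] by simp

lemma tr_pbeta: "pbeta t t' \<Longrightarrow> cconv (tr t) (tr t')"
proof (induction rule: pbeta.induct)
  case (beta x v t u)
  have "cconv (CApp (clam x (tr v) (tr t)) (LCons (tr u) LNil)) (CApp (csub (tr u) x (tr v) (tr t)) LNil)"
    by (intro cconv_red b_beta)
  also have "cconv \<dots> (csub (tr u) x (tr v) (tr t))"
    by (intro cconv_red b_nil)
  also have "cconv \<dots> (tr (psubst x u t))"
    by (rule csub_tr)
  finally show ?case using cconv_tr_PApp[of "plam x v t" u] by (metis cconv_trans tr_plam)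
next
  case (app1 t t' u)
  have "cconv (tr (PApp t u)) (CApp (tr t') (LCons (tr u) LNil))"
    by (rule cconv_trans[OF cconv_tr_PApp cconv_CApp[OF app1.IH lconv_refl]])
  then show ?case by (rule cconv_trans[OF _ cconv_sym[OF cconv_tr_PApp]])
next
  case (app2 u u' t)
  then show ?case by (simp add: cconv_trl lconv_LCons)
qed (simp_all add: tr_ppi tr_plam cconv_cpi cconv_clam)

lemma tr_pconv:
  assumes "pconv t u"
  shows "cconv (tr t) (tr u)"
  using assms unfolding pconv_def
proof (induction rule: equivclp_induct)
  case (step y z)
  then show ?case using tr_pbeta cconv_sym cconv_trans by metis
qed simp

section \<open>Every term is convertible to a translated one\<close>

lemma pfv_pinst: "pfv (pinst \<sigma> t) = (\<Union>x\<in>pfv t. pfv (\<sigma> x))"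
proof -
  have ups: "{n. \<exists>m\<in>S. Suc n \<in> pfv (ups \<sigma> m)} = (\<Union>x\<in>{n. Suc n \<in> S}. pfv (\<sigma> x))"
    for S and \<sigma> :: "nat \<Rightarrow> 's pterm"
  proof -
    have "Suc n \<in> pfv (ups \<sigma> m) \<longleftrightarrow> (\<exists>k. m = Suc k \<and> n \<in> pfv (\<sigma> k))" for n m
      by (cases m) (auto simp: ups_def pfv_pren)
    then show ?thesis by auto
  qed
  show ?thesis
    by (induction t arbitrary: \<sigma>) (simp_all add: ups UN_Un)
qed

lemma pfv_psubst: "pfv (psubst x u t) \<subseteq> pfv u \<union> (pfv t - {x})"
  by (auto simp: psubst_def pfv_pinst split: if_splits)

lemma ups_ups: "pinst (ups \<sigma>) \<circ> ups \<tau> = ups (pinst \<sigma> \<circ> \<tau>)"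
proof
  fix n
  have "ups \<sigma> \<circ> Suc = pren Suc \<circ> \<sigma>"
    by (auto simp: ups_def)
  then show "(pinst (ups \<sigma>) \<circ> ups \<tau>) n = ups (pinst \<sigma> \<circ> \<tau>) n"
    by (cases n) (simp_all add: ups_def[of \<tau>] ups_def[of "pinst \<sigma> \<circ> \<tau>"] ups_def[of \<sigma> ] pinst_pren pren_pinst)
qed

lemma pinst_pinst: "pinst \<sigma> (pinst \<tau> t) = pinst (pinst \<sigma> \<circ> \<tau>) t"
  by (induction t arbitrary: \<sigma> \<tau>) (simp_all add: ups_ups)

lemma pinst_PVar: "pinst PVar t = t"
proof -
  have "ups PVar = PVar"
    by (auto simp: ups_def fun_eq_iff split: nat.splits)
  note [simp] = this
  show ?thesis by (induction t) simp_all
qed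

lemma psubst_fresh: "x \<notin> pfv t \<Longrightarrow> psubst x u t = t"
  unfolding psubst_def by (subst (2) pinst_PVar[symmetric], rule pinst_cong) auto

text \<open>The substitution lemma of the lambda calculus, the source of its explicit counterpart
  \<open>csub_csub\<close>.\<close>

lemma psubst_psubst:
  assumes "x \<noteq> y" "y \<notin> pfv u"
  shows "psubst x u (psubst y v t) = psubst y (psubst x u v) (psubst x u t)"
  using assms psubst_fresh[of y u "psubst x u v"]
  by (auto simp: psubst_def pinst_pinst intro!: pinst_cong)

lemma psubst_alpha:
  assumes "y \<notin> pfv t"
  shows "psubst y u (pren (id(x := y)) t) = psubst x u t"
  using assms by (auto simp: psubst_def pinst_pren intro!: pinst_cong)

lemma cfv_lfv_tr:
  "cfv (tr t) = pfv t"
  "cfv (trl l t) = pfv t \<union> lfv l"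
  by (induction t and l t rule: tr_trl.induct) auto

section \<open>Application to several arguments\<close>

definition papps :: "'s pterm \<Rightarrow> 's pterm list \<Rightarrow> 's pterm" where
  "papps t ts = foldl PApp t ts"

lemma papps_simps [simp]:
  "papps t [] = t"
  "papps t (u # us) = papps (PApp t u) us"
  "papps t (us @ [v]) = PApp (papps t us) v"
  by (simp_all add: papps_def)

lemma trargs_simps [simp]:
  "trargs [] = LNil"
  "trargs (t # ts) = LCons (tr t) (trargs ts)"
  by (simp_all add: trargs_def)

lemma pfv_papps: "pfv (papps t ts) = pfv t \<union> (\<Union>u\<in>set ts. pfv u)"
  by (induction ts arbitrary: t) auto

lemma psubst_papps: "psubst x u (papps t ts) = papps (psubst x u t) (map (psubst x u) ts)"
  by (induction ts arbitrary: t) (auto simp: psubst_def)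

text \<open>The accumulator that \<open>trl l\<close> has reached after peeling the arguments
  \<open>ts\<close> off a spine.\<close>

definition lapp :: "'s pterm list \<Rightarrow> 's clist \<Rightarrow> 's clist" where
  "lapp ts l = foldr (\<lambda>t l. LCons (tr t) l) ts l"

lemma trl_papps: "trl l (papps t ts) = trl (lapp ts l) t"
  by (induction ts arbitrary: t) (auto simp: lapp_def)

lemma lapp_LNil: "lapp ts LNil = trargs ts"
  by (simp add: lapp_def trargs_def)

lemma tr_papps: "cconv (CApp (tr t) (trargs ts)) (tr (papps t ts))"
proof -
  have "cconv (CApp (tr t) (trargs ts)) (trl LNil (papps t ts))"
    using CApp_tr[of t "trargs ts"] by (simp add: trl_papps lapp_LNil)
  also have "cconv \<dots> (tr (papps t ts))"
    by (rule tr_trl_LNil)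
  finally show ?thesis .
qed

lemma LCat_trargs: "lconv (LCat (trargs ts) (trargs us)) (trargs (ts @ us))"
proof (induction ts)
  case (Cons t ts)
  have "lconv (LCat (trargs (t # ts)) (trargs us)) (LCons (tr t) (LCat (trargs ts) (trargs us)))"
    by (simp add: lconv_red a_cons)
  also have "lconv \<dots> (LCons (tr t) (trargs (ts @ us)))"
    using Cons by (intro lconv_LCons) auto
  finally show ?case by simp
qed (simp add: lconv_red a_nil)

lemma lsub_trargs: "lconv (lsub (tr u) x G (trargs ts)) (trargs (map (psubst x u) ts))"
proof (induction ts)
  case (Cons t ts)
  have "lconv (lsub (tr u) x G (trargs (t # ts)))
      (LCons (csub (tr u) x G (tr t)) (lsub (tr u) x G (trargs ts)))"
    by (simp add: lconv_red s_cons)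
  also have "lconv \<dots> (LCons (tr (psubst x u t)) (trargs (map (psubst x u) ts)))"
    using Cons by (intro lconv_LCons csub_tr)
  finally show ?case by simp
qed (simp add: lconv_red s_nil)

lemma ex_tr_trargs:
  fixes M :: "'s cterm" and l :: "'s clist"
  shows "\<exists>t. cconv M (tr t) \<and> pfv t \<subseteq> cfv M"
    and "\<exists>ts. lconv l (trargs ts) \<and> (\<Union>t\<in>set ts. pfv t) \<subseteq> lfv l"
proof (induction M and l rule: cterm_clist_named_induct)
  case (cpi x A B)
  then obtain T U where "cconv A (tr T)" "pfv T \<subseteq> cfv A" "cconv B (tr U)" "pfv U \<subseteq> cfv B"
    by blast
  then show ?case
    by (intro exI[of _ "ppi x T U"]) (auto simp: cconv_cpi tr_ppi pfv_ppi cfv_cpi)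
next
  case (clam x A M)
  then obtain T t where "cconv A (tr T)" "pfv T \<subseteq> cfv A" "cconv M (tr t)" "pfv t \<subseteq> cfv M"
    by blast
  then show ?case
    by (intro exI[of _ "plam x T t"]) (auto simp: cconv_clam tr_plam pfv_plam cfv_clam)
next
  case (CSort s)
  then show ?case by (intro exI[of _ "PSort s"]) simp
next
  case (CVar x l)
  then obtain ts where ts: "lconv l (trargs ts)" "(\<Union>t\<in>set ts. pfv t) \<subseteq> lfv l"
    by blast
  have "cconv (CVar x l) (trl LNil (papps (PVar x) ts))"
    using ts(1) by (simp add: trl_papps lapp_LNil cconv_CVar)
  also have "cconv \<dots> (tr (papps (PVar x) ts))"
    by (rule tr_trl_LNil)
  finally show ?case
    using ts(2) by (intro exI[of _ "papps (PVar x) ts"]) (auto simp: pfv_papps)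
next
  case (CApp M l)
  then obtain t ts where *: "cconv M (tr t)" "pfv t \<subseteq> cfv M"
    "lconv l (trargs ts)" "(\<Union>t\<in>set ts. pfv t) \<subseteq> lfv l"
    by blast
  then have "cconv (CApp M l) (tr (papps t ts))"
    by (intro cconv_trans[OF cconv_CApp tr_papps])
  then show ?case using *
    by (intro exI[of _ "papps t ts"]) (auto simp: pfv_papps)
next
  case (csub N x A M)
  then obtain u t where *: "cconv N (tr u)" "pfv u \<subseteq> cfv N" "cconv M (tr t)" "pfv t \<subseteq> cfv M"
    by blast
  then have "cconv (csub N x A M) (tr (psubst x u t))"
    by (intro cconv_csub_tr)
  then show ?case using * pfv_psubst[of x u t]
    by (intro exI[of _ "psubst x u t"]) (auto simp: cfv_csub)
next
  case LNil
  then show ?case by (intro exI[of _ "[]"]) simp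
next
  case (LCons M l)
  then obtain t ts where "cconv M (tr t)" "pfv t \<subseteq> cfv M"
    "lconv l (trargs ts)" "(\<Union>t\<in>set ts. pfv t) \<subseteq> lfv l"
    by blast
  then show ?case
    by (intro exI[of _ "t # ts"]) (auto simp: lconv_LCons)
next
  case (LCat l l')
  then obtain ts us where *: "lconv l (trargs ts)" "(\<Union>t\<in>set ts. pfv t) \<subseteq> lfv l"
    "lconv l' (trargs us)" "(\<Union>t\<in>set us. pfv t) \<subseteq> lfv l'"
    by blast
  then have "lconv (LCat l l') (trargs (ts @ us))"
    by (intro lconv_trans[OF lconv_LCat LCat_trargs])
  then show ?case using * by (intro exI[of _ "ts @ us"]) auto
next
  case (lsub N x A l)
  then obtain u ts where *: "cconv N (tr u)" "pfv u \<subseteq> cfv N"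
    "lconv l (trargs ts)" "(\<Union>t\<in>set ts. pfv t) \<subseteq> lfv l"
    by blast
  then have "lconv (lsub N x A l) (trargs (map (psubst x u) ts))"
    by (intro lconv_trans[OF lconv_lsub[OF _ cconv_refl] lsub_trargs])
  moreover have "(\<Union>t\<in>set (map (psubst x u) ts). pfv t) \<subseteq> lfv (lsub N x A l)"
    using * pfv_psubst[of x u] by (fastforce simp: lfv_lsub)
  ultimately show ?case by blast
qed

text \<open>\<open>M\<close> may itself contain explicit substitutions, in front of which
  \<open>csub P x A\<close> is stuck; on a translated representative the implicit substitution
  simply disappears.\<close>

lemma csub_fresh:
  assumes "x \<notin> cfv M"
  shows "cconv (csub P x A M) M"
proof -
  obtain u t where u: "cconv P (tr u)" and t: "cconv M (tr t)" "pfv t \<subseteq> cfv M"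
    using ex_tr_trargs(1) by meson
  have "cconv (csub P x A M) (tr (psubst x u t))"
    using u t by (intro cconv_csub_tr)
  also have "psubst x u t = t"
    using t assms by (intro psubst_fresh) auto
  also have "cconv (tr t) M"
    using t cconv_sym by blast
  finally show ?thesis .
qed

text \<open>Both sides are convertible to the translations of the two sides of the implicit
  substitution lemma. The annotations \<open>B\<close> and \<open>C\<close> are unrelated because no
  substitution rule inspects them.\<close>

lemma csub_csub:
  assumes "x \<noteq> y" "y \<notin> cfv P"
  shows "cconv (csub P x A (csub N y B M)) (csub (csub P x A N) y C (csub P x A M))"
proof -
  obtain u v t where u: "cconv P (tr u)" "pfv u \<subseteq> cfv P" and v: "cconv N (tr v)"
    and t: "cconv M (tr t)"
    using ex_tr_trargs(1) by meson
  have *: "cconv (csub P x A K) (tr (psubst x u k))" if "cconv K (tr k)" for K k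
    using u that by (intro cconv_csub_tr)
  have "cconv (csub N y B M) (tr (psubst y v t))"
    using v t by (intro cconv_csub_tr)
  then have "cconv (csub P x A (csub N y B M)) (tr (psubst x u (psubst y v t)))"
    by (rule *)
  also have "psubst x u (psubst y v t) = psubst y (psubst x u v) (psubst x u t)"
    using assms u by (intro psubst_psubst) auto
  also have "cconv (tr \<dots>) (csub (csub P x A N) y C (csub P x A M))"
    using * v t by (intro cconv_sym[OF cconv_csub_tr])
  finally show ?thesis .
qed

lemma cconv_csub_cpi:
  assumes "y \<noteq> x" "y \<notin> cfv P" "y \<notin> cfv A"
  shows "cconv (csub P x A (cpi y B D)) (cpi y (csub P x A B) (csub P x A D))"
  using assms by (intro cconv_red s_pi)

section \<open>Renaming in typing derivations\<close>

definition renv :: "(name \<Rightarrow> name) \<Rightarrow> 's cenv \<Rightarrow> 's cenv" where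
  "renv \<rho> \<Gamma> = map (\<lambda>(x, A). (\<rho> x, cren \<rho> A)) \<Gamma>"

lemma renv_append [simp]: "renv \<rho> (\<Gamma> @ \<Delta>) = renv \<rho> \<Gamma> @ renv \<rho> \<Delta>"
  and renv_Cons [simp]: "renv \<rho> ((x, A) # \<Gamma>) = (\<rho> x, cren \<rho> A) # renv \<rho> \<Gamma>"
  and renv_Nil [simp]: "renv \<rho> [] = []"
  by (simp_all add: renv_def)

lemma dom_renv: "fst ` set (renv \<rho> \<Gamma>) = \<rho> ` fst ` set \<Gamma>"
  by (force simp: renv_def image_iff)

lemma renv_esub: "inj \<rho> \<Longrightarrow> renv \<rho> (esub P x A \<Delta>) = esub (cren \<rho> P) (\<rho> x) (cren \<rho> A) (renv \<rho> \<Delta>)"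
  by (auto simp: renv_def esub_def cren_named)

lemma renv_mem: "(x, A) \<in> set \<Gamma> \<Longrightarrow> (\<rho> x, cren \<rho> A) \<in> set (renv \<rho> \<Gamma>)"
  by (force simp: renv_def)

lemma subenv_renv:
  assumes "inj \<rho>" "subenv \<Gamma> \<Delta>"
  shows "subenv (renv \<rho> \<Gamma>) (renv \<rho> \<Delta>)"
  using assms cconv_cren[OF assms(1)] renv_mem[of _ _ \<Delta> \<rho>]
  unfolding subenv_def by (fastforce simp: renv_def)

lemma cren_range_CSort: "cren \<rho> C \<in> range CSort \<longleftrightarrow> C \<in> range CSort"
  by (cases C) auto

text \<open>Equivariance of typing. It is applied to transpositions, to move a derivation away from
  names that clash.\<close>

lemma typing_cren:
  assumes inj: "inj \<rho>"
  shows "cwf Ax Rl \<Gamma> \<Longrightarrow> cwf Ax Rl (renv \<rho> \<Gamma>)"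
    and "cty Ax Rl \<Gamma> M A \<Longrightarrow> cty Ax Rl (renv \<rho> \<Gamma>) (cren \<rho> M) (cren \<rho> A)"
    and "lty Ax Rl \<Gamma> A l B \<Longrightarrow> lty Ax Rl (renv \<rho> \<Gamma>) (cren \<rho> A) (lren \<rho> l) (cren \<rho> B)"
proof (induction rule: cwf_cty_lty.inducts)
  case (cwf_ext \<Gamma> A s x)
  then have "\<rho> x \<notin> fst ` set (renv \<rho> \<Gamma>)"
    by (simp add: dom_renv inj_image_mem_iff[OF inj])
  then show ?case
    using cwf_ext.IH by (auto intro: cwf_cty_lty.cwf_ext)
next
  case (cty_var \<Gamma> A l B x)
  then show ?case by (auto intro!: cwf_cty_lty.cty_var renv_mem)
next
  case (cty_conv \<Gamma> M A B s)
  then show ?case by (auto intro: cwf_cty_lty.cty_conv cconv_cren[OF inj])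
next
  case (lty_conv_right \<Gamma> C l A B s)
  then show ?case by (auto intro: cwf_cty_lty.lty_conv_right cconv_cren[OF inj])
next
  case (lty_conv_left \<Gamma> A l C B s)
  then show ?case by (auto intro: cwf_cty_lty.lty_conv_left cconv_cren[OF inj])
next
  case (lty_sub \<Gamma> P A x \<Delta> B l C \<Delta>')
  have "subenv (renv \<rho> \<Gamma> @ esub (cren \<rho> P) (\<rho> x) (cren \<rho> A) (renv \<rho> \<Delta>)) (renv \<rho> \<Delta>')"
    using subenv_renv[OF inj \<open>subenv (\<Gamma> @ esub P x A \<Delta>) \<Delta>'\<close>] by (simp add: renv_esub[OF inj])
  then show ?case
    using lty_sub by (auto simp: cren_named[OF inj] intro!: cwf_cty_lty.lty_sub)
next
  case (cty_sub \<Gamma> P A x \<Delta> M C \<Delta>' C')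
  have "subenv (renv \<rho> \<Gamma> @ esub (cren \<rho> P) (\<rho> x) (cren \<rho> A) (renv \<rho> \<Delta>)) (renv \<rho> \<Delta>')"
    using subenv_renv[OF inj \<open>subenv (\<Gamma> @ esub P x A \<Delta>) \<Delta>'\<close>] by (simp add: renv_esub[OF inj])
  then show ?case
    unfolding cren_named(3)[OF inj]
    using cty_sub
    by (rule_tac cwf_cty_lty.cty_sub[where C = "cren \<rho> C"])
      (auto simp: cren_named[OF inj] cren_range_CSort)
next
  case (cty_pi \<Gamma> A s1 x B s2 s3)
  then show ?case by (auto simp: cren_named[OF inj] intro: cwf_cty_lty.cty_pi)
next
  case (cty_lam \<Gamma> x A B s M)
  then show ?case by (auto simp: cren_named[OF inj] intro: cwf_cty_lty.cty_lam)
next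
  case (lty_cons \<Gamma> x A B s M l C)
  then show ?case by (auto simp: cren_named[OF inj] intro: cwf_cty_lty.lty_cons)
qed (auto intro: cwf_cty_lty.intros)

section \<open>Scoping of environments and judgements\<close>

definition scoped :: "'s cenv \<Rightarrow> bool" where
  "scoped \<Gamma> \<longleftrightarrow> (\<forall>(x, A) \<in> set \<Gamma>. cfv A \<subseteq> fst ` set \<Gamma>)"

lemma dom_esub [simp]: "fst ` set (esub P x A \<Delta>) = fst ` set \<Delta>"
  by (force simp: esub_def image_iff)

lemma subenv_dom: "subenv \<Gamma> \<Delta> \<Longrightarrow> fst ` set \<Gamma> \<subseteq> fst ` set \<Delta>"
  by (force simp: subenv_def)

lemma typing_scoped:
  shows "cwf Ax Rl \<Gamma> \<Longrightarrow> scoped \<Gamma>"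
    and "cty Ax Rl \<Gamma> M A \<Longrightarrow>
      cwf Ax Rl \<Gamma> \<and> scoped \<Gamma> \<and> cfv M \<subseteq> fst ` set \<Gamma> \<and> cfv A \<subseteq> fst ` set \<Gamma>"
    and "lty Ax Rl \<Gamma> A l B \<Longrightarrow>
      cwf Ax Rl \<Gamma> \<and> scoped \<Gamma> \<and> cfv A \<subseteq> fst ` set \<Gamma> \<and> lfv l \<subseteq> fst ` set \<Gamma> \<and> cfv B \<subseteq> fst ` set \<Gamma>"
proof (induction rule: cwf_cty_lty.inducts)
  case cwf_empty
  show ?case by (simp add: scoped_def)
next
  case (cwf_ext \<Gamma> A s x)
  then show ?case unfolding scoped_def by auto
next
  case (cty_var \<Gamma> A l B x)
  moreover have "x \<in> fst ` set \<Gamma>"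
    using \<open>(x, A) \<in> set \<Gamma>\<close> by (rule image_eqI[rotated]) simp
  ultimately show ?case by simp
next
  case (lty_sub \<Gamma> P A x \<Delta> B l C \<Delta>')
  have "fst ` set (\<Gamma> @ esub P x A \<Delta>) \<subseteq> fst ` set \<Delta>'"
    using \<open>subenv (\<Gamma> @ esub P x A \<Delta>) \<Delta>'\<close> by (rule subenv_dom)
  then have "fst ` set \<Gamma> \<subseteq> fst ` set \<Delta>'" "fst ` set \<Delta> \<subseteq> fst ` set \<Delta>'"
    by (simp_all add: image_Un)
  then show ?case using lty_sub
    unfolding cfv_csub lfv_lsub set_append image_Un list.set image_insert image_empty fst_conv by blast
next
  case (cty_sub \<Gamma> P A x \<Delta> M C \<Delta>' C')
  have "fst ` set (\<Gamma> @ esub P x A \<Delta>) \<subseteq> fst ` set \<Delta>'"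
    using \<open>subenv (\<Gamma> @ esub P x A \<Delta>) \<Delta>'\<close> by (rule subenv_dom)
  then have "fst ` set \<Gamma> \<subseteq> fst ` set \<Delta>'" "fst ` set \<Delta> \<subseteq> fst ` set \<Delta>'"
    by (simp_all add: image_Un)
  then have *: "cfv (csub P x A M) \<subseteq> fst ` set \<Delta>'" "cfv (csub P x A C) \<subseteq> fst ` set \<Delta>'"
    using cty_sub
    unfolding cfv_csub set_append image_Un list.set image_insert image_empty fst_conv by blast+
  have "cfv C' \<subseteq> fst ` set \<Delta>'"
  proof (cases "C \<in> range CSort")
    case True
    then show ?thesis using \<open>C' = (if C \<in> range CSort then C else csub P x A C)\<close> by auto
  next
    case False
    then show ?thesis using * \<open>C' = (if C \<in> range CSort then C else csub P x A C)\<close> by simp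
  qed
  then show ?case using * cty_sub by blast
next
  case (cty_pi \<Gamma> A s1 x B s2 s3)
  then show ?case unfolding cfv_cpi by auto
next
  case (cty_lam \<Gamma> x A B s M)
  then show ?case unfolding cfv_cpi cfv_clam by auto
next
  case (lty_cons \<Gamma> x A B s M l C)
  then show ?case unfolding cfv_cpi cfv_csub by auto
qed simp_all

lemma cty_cwf: "cty Ax Rl \<Gamma> M A \<Longrightarrow> cwf Ax Rl \<Gamma>"
  and cty_cfv: "cty Ax Rl \<Gamma> M A \<Longrightarrow> cfv M \<subseteq> fst ` set \<Gamma>"
  and cty_cfv_type: "cty Ax Rl \<Gamma> M A \<Longrightarrow> cfv A \<subseteq> fst ` set \<Gamma>"
  by (simp_all add: typing_scoped)

lemma cren_fixed: "(\<And>z. z \<in> cfv A \<Longrightarrow> \<rho> z = z) \<Longrightarrow> cren \<rho> A = A"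
  using cren_lren_cong(1)[of A \<rho> id] by (simp add: cren_lren_id)

lemma renv_fixed:
  assumes "scoped \<Gamma>" "\<And>z. z \<in> fst ` set \<Gamma> \<Longrightarrow> \<rho> z = z"
  shows "renv \<rho> \<Gamma> = \<Gamma>"
  unfolding renv_def
proof (rule map_idI, clarify)
  fix z A assume z: "(z, A) \<in> set \<Gamma>"
  then have "cfv A \<subseteq> fst ` set \<Gamma>" using assms(1) by (auto simp: scoped_def)
  then have "cren \<rho> A = A" using assms(2) by (intro cren_fixed) auto
  moreover have "\<rho> z = z" using z by (intro assms(2) image_eqI[of _ fst "(z, A)"]) auto
  ultimately show "\<rho> z = z \<and> cren \<rho> A = A" by simp
qed

section \<open>Generation\<close>

lemma named_neq:
  "cpi x A B \<noteq> CSort s" "cpi x A B \<noteq> CVar y l" "cpi x A B \<noteq> CApp M l"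
  "clam x A B \<noteq> CSort s" "clam x A B \<noteq> CVar y l" "clam x A B \<noteq> CApp M l"
  "csub N x A B \<noteq> CSort s" "csub N x A B \<noteq> CVar y l" "csub N x A B \<noteq> CApp M l"
  "clam y A M \<noteq> cpi x C B" "csub N x C B \<noteq> cpi y A M" "csub N x C B \<noteq> clam y A M"
  by (simp_all add: cpi_def clam_def csub_def)

declare named_neq [simp] named_neq [symmetric, simp]

lemma cwf_snoc:
  assumes "cwf Ax Rl (\<Gamma> @ [(x, A)])"
  obtains s where "cty Ax Rl \<Gamma> A (CSort s)" "x \<notin> fst ` set \<Gamma>"
  using assms by (cases rule: cwf.cases) auto

text \<open>Two named bodies of one product differ by the swap of their binders:
  \<open>unbindr y \<circ> bindr x\<close> agrees with the transposition except at \<open>y\<close>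
  when \<open>y \<noteq> x\<close>, and there the second assumption says that \<open>y\<close> does
  not occur.\<close>

lemma cpi_body:
  assumes "cpi x A B = cpi y A' B'" "y \<notin> cfv B - {x}"
  shows "A' = A" "B' = cren (transpose x y) B"
proof -
  have eq: "A = A'" "cren (bindr x) B = cren (bindr y) B'"
    using assms by (simp_all add: cpi_def)
  then show "A' = A" by simp
  have "B' = cren (unbindr y \<circ> bindr x) B"
    using eq(2) by (metis cren_unbindr_bindr cren_lren_comp(1))
  also have "\<dots> = cren (transpose x y) B"
    using assms(2)
    by (intro cren_lren_cong) (auto simp: unbindr_def bindr_def transpose_def)
  finally show "B' = cren (transpose x y) B" .
qed

lemma cty_cpi_body:
  assumes "cty Ax Rl (\<Gamma> @ [(x, A)]) B (CSort s)" "cpi x A B = cpi y A' B'" "y \<notin> fst ` set \<Gamma>"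
  shows "cty Ax Rl (\<Gamma> @ [(y, A)]) B' (CSort s)"
proof -
  let ?\<pi> = "transpose x y"
  obtain s' where A: "cty Ax Rl \<Gamma> A (CSort s')" and x: "x \<notin> fst ` set \<Gamma>"
    using cwf_snoc[OF cty_cwf[OF assms(1)]] .
  have fix_dom: "?\<pi> w = w" if "w \<in> fst ` set \<Gamma>" for w
    using that x assms(3) by (auto simp: transpose_def)
  have "y \<notin> cfv B - {x}"
    using cty_cfv[OF assms(1)] assms(3) by auto
  then have "B' = cren ?\<pi> B" using assms(2) by (rule cpi_body(2)[rotated])
  moreover have "renv ?\<pi> \<Gamma> = \<Gamma>"
    by (rule renv_fixed[OF typing_scoped(1)[OF cty_cwf[OF A]] fix_dom])
  moreover have "cren ?\<pi> A = A"
    using cty_cfv[OF A] fix_dom by (auto intro: cren_fixed)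
  ultimately show ?thesis
    using typing_cren(2)[OF _ assms(1), of ?\<pi>] by simp
qed

text \<open>A derivation fixes some binder name for the product; \<open>cty_cpi_body\<close>
  exchanges it for the requested \<open>y\<close>. The type \<open>C\<close> is left unconstrained,
  since conversions may have altered it.\<close>

lemma cty_cpiD:
  assumes "cty Ax Rl \<Gamma> (cpi y A B) C" "y \<notin> fst ` set \<Gamma>"
  obtains s1 s2 s3 where "(s1, s2, s3) \<in> Rl"
    "cty Ax Rl \<Gamma> A (CSort s1)" "cty Ax Rl (\<Gamma> @ [(y, A)]) B (CSort s2)"
proof -
  have "cty Ax Rl \<Gamma> M C \<Longrightarrow> M = cpi y A B \<longrightarrow> y \<notin> fst ` set \<Gamma> \<longrightarrow>
      (\<exists>s1 s2 s3. (s1, s2, s3) \<in> Rl \<and> cty Ax Rl \<Gamma> A (CSort s1) \<and>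
        cty Ax Rl (\<Gamma> @ [(y, A)]) B (CSort s2))" for M
  proof (induction rule: cwf_cty_lty.inducts(2)[of _ _ _ _ _ "\<lambda>_. True" _ "\<lambda>_ _ _ _. True"])
    case (cty_pi \<Gamma> A' s1 x B' s2 s3)
    show ?case
    proof (intro impI)
      assume eq: "cpi x A' B' = cpi y A B" and y: "y \<notin> fst ` set \<Gamma>"
      have "A' = A" using eq by (simp add: cpi_def)
      moreover have "cty Ax Rl (\<Gamma> @ [(y, A')]) B (CSort s2)"
        using \<open>cty Ax Rl (\<Gamma> @ [(x, A')]) B' (CSort s2)\<close> eq y by (rule cty_cpi_body)
      ultimately show "\<exists>s1 s2 s3. (s1, s2, s3) \<in> Rl \<and> cty Ax Rl \<Gamma> A (CSort s1) \<and>
        cty Ax Rl (\<Gamma> @ [(y, A)]) B (CSort s2)"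
        using cty_pi by blast
    qed
  qed simp_all
  then show ?thesis using assms that by blast
qed

lemma cty_CSortD:
  assumes "cty Ax Rl \<Gamma> (CSort s) C"
  obtains s' where "(s, s') \<in> Ax"
proof -
  have "cty Ax Rl \<Gamma> M C \<Longrightarrow> M = CSort s \<longrightarrow> (\<exists>s'. (s, s') \<in> Ax)" for M
    by (induction rule: cwf_cty_lty.inducts(2)[of _ _ _ _ _ "\<lambda>_. True" _ "\<lambda>_ _ _ _. True"]) auto
  then show ?thesis using assms that by blast
qed

lemma cty_CSort_cwf:
  assumes "cty Ax Rl \<Gamma> (CSort s) C" "cwf Ax Rl \<Delta>"
  obtains s' where "cty Ax Rl \<Delta> (CSort s) (CSort s')"
  using assms by (metis cty_CSortD cty_sort)

text \<open>Conversions applied after \<open>cty_var\<close> are absorbed into the list by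
  \<open>lty_conv_right\<close>, so the final type \<open>B\<close> is kept exactly. The same works
  for \<open>cty_app\<close>.\<close>

lemma cty_CVarD:
  assumes "cty Ax Rl \<Gamma> (CVar x l) B"
  obtains A where "(x, A) \<in> set \<Gamma>" "lty Ax Rl \<Gamma> A l B"
proof -
  have "cty Ax Rl \<Gamma> M B \<Longrightarrow> M = CVar x l \<longrightarrow> (\<exists>A. (x, A) \<in> set \<Gamma> \<and> lty Ax Rl \<Gamma> A l B)" for M
  proof (induction rule: cwf_cty_lty.inducts(2)[of _ _ _ _ _ "\<lambda>_. True" _ "\<lambda>_ _ _ _. True"])
    case (cty_conv \<Gamma> M A B s)
    then show ?case
      using lty_conv_right[OF _ \<open>cty Ax Rl \<Gamma> B (CSort s)\<close> \<open>cconv A B\<close>] by meson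
  next
    case (cty_var \<Gamma> A l' B x')
    then show ?case by (metis cterm.inject(4))
  qed simp_all
  then show ?thesis using assms that by blast
qed

lemma cty_CAppD:
  assumes "cty Ax Rl \<Gamma> (CApp N l) B"
  obtains A where "cty Ax Rl \<Gamma> N A" "lty Ax Rl \<Gamma> A l B"
proof -
  have "cty Ax Rl \<Gamma> M B \<Longrightarrow> M = CApp N l \<longrightarrow> (\<exists>A. cty Ax Rl \<Gamma> N A \<and> lty Ax Rl \<Gamma> A l B)" for M
  proof (induction rule: cwf_cty_lty.inducts(2)[of _ _ _ _ _ "\<lambda>_. True" _ "\<lambda>_ _ _ _. True"])
    case (cty_conv \<Gamma> M A B s)
    then show ?case
      using lty_conv_right[OF _ \<open>cty Ax Rl \<Gamma> B (CSort s)\<close> \<open>cconv A B\<close>] by meson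
  next
    case (cty_app \<Gamma> M A l' B)
    then show ?case by (metis cterm.inject(5))
  qed simp_all
  then show ?thesis using assms that by blast
qed

section \<open>Weakening\<close>

lemma subenv_refl: "subenv \<Gamma> \<Gamma>"
  unfolding subenv_def by (auto intro: cconv_refl)

lemma subenv_trans:
  assumes "subenv \<Gamma> \<Delta>" "subenv \<Delta> \<Theta>"
  shows "subenv \<Gamma> \<Theta>"
  unfolding subenv_def
proof clarify
  fix x A assume "(x, A) \<in> set \<Gamma>"
  then obtain B where B: "(x, B) \<in> set \<Delta>" "cconv A B"
    using assms(1) by (auto simp: subenv_def)
  then obtain C where "(x, C) \<in> set \<Theta>" "cconv B C"
    using assms(2) by (auto simp: subenv_def)
  then show "\<exists>B. (x, B) \<in> set \<Theta> \<and> cconv A B"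
    using cconv_trans[OF B(2)] by blast
qed

lemma subenv_snoc: "subenv \<Gamma> \<Delta> \<Longrightarrow> cconv A B \<Longrightarrow> subenv (\<Gamma> @ [(x, A)]) (\<Delta> @ [(x, B)])"
  unfolding subenv_def by auto

lemma subset_subenv: "set \<Gamma> \<subseteq> set \<Delta> \<Longrightarrow> subenv \<Gamma> \<Delta>"
  unfolding subenv_def by (auto intro: cconv_refl)

text \<open>
  A binder \<open>y\<close> in a judgement over \<open>\<Gamma>\<close> may clash with a name of \<open>\<Delta>\<close>.  Swapping \<open>y\<close> with a name
  unknown to \<open>\<Gamma>\<close> and \<open>\<Delta>\<close> fixes \<open>\<Gamma>\<close> and the judgement and frees \<open>y\<close> in \<open>\<Delta>\<close>; swapping back afterwards
  gives the judgement over \<open>\<Delta>\<close>.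
\<close>

lemma wlog_fresh_binder:
  assumes "scoped \<Gamma>" "y \<notin> fst ` set \<Gamma>" "cfv M \<subseteq> fst ` set \<Gamma>" "cfv A \<subseteq> fst ` set \<Gamma>"
    and E: "E \<Gamma> \<Delta>" "cwf Ax Rl \<Delta>"
    and ren: "\<And>\<rho> \<Gamma> \<Delta>. inj \<rho> \<Longrightarrow> E \<Gamma> \<Delta> \<Longrightarrow> E (renv \<rho> \<Gamma>) (renv \<rho> \<Delta>)"
    and fresh: "\<And>\<Delta>. E \<Gamma> \<Delta> \<Longrightarrow> cwf Ax Rl \<Delta> \<Longrightarrow> y \<notin> fst ` set \<Delta> \<Longrightarrow> cty Ax Rl \<Delta> M A"
  shows "cty Ax Rl \<Delta> M A"
proof -
  have "finite (fst ` set \<Gamma> \<union> fst ` set \<Delta>)" by simp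
  then obtain z where z: "z \<notin> fst ` set \<Gamma>" "z \<notin> fst ` set \<Delta>"
    using ex_new_if_finite infinite_UNIV_nat by blast
  define \<pi> where "\<pi> = transpose y z"
  have inj: "inj \<pi>" by (simp add: \<pi>_def)
  have fix_dom: "\<pi> w = w" if "w \<in> fst ` set \<Gamma>" for w
    using that z(1) assms(2) by (auto simp: \<pi>_def transpose_def)
  have \<Gamma>: "renv \<pi> \<Gamma> = \<Gamma>" by (rule renv_fixed[OF assms(1) fix_dom])
  have M: "cren \<pi> M = M" and A: "cren \<pi> A = A"
    using assms(3,4) fix_dom by (auto intro!: cren_fixed)
  have "\<pi> \<circ> \<pi> = id" by (simp add: \<pi>_def)
  then have \<Delta>: "renv \<pi> (renv \<pi> \<Delta>) = \<Delta>"
    unfolding renv_def map_map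
    by (intro map_idI) (auto simp: cren_lren_comp cren_lren_id fun_eq_iff \<pi>_def)
  have "\<pi> y = z" by (simp add: \<pi>_def)
  have "y \<notin> fst ` set (renv \<pi> \<Delta>)"
  proof
    assume "y \<in> fst ` set (renv \<pi> \<Delta>)"
    then have "\<pi> y \<in> fst ` set (renv \<pi> (renv \<pi> \<Delta>))" unfolding dom_renv[of \<pi> "renv \<pi> \<Delta>"] by (rule imageI)
    then show False using z(2) \<open>\<pi> y = z\<close> by (simp add: \<Delta>)
  qed
  moreover have "E \<Gamma> (renv \<pi> \<Delta>)" using ren[OF inj E(1)] by (simp add: \<Gamma>)
  ultimately have "cty Ax Rl (renv \<pi> \<Delta>) M A"
    using fresh typing_cren(1)[OF inj E(2)] by blast
  from typing_cren(2)[OF inj this] show ?thesis by (simp add: \<Delta> M A)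
qed

lemma cwf_prefix: "cwf Ax Rl (\<Gamma> @ \<Delta>) \<Longrightarrow> cwf Ax Rl \<Gamma>"
proof (induction \<Delta> rule: rev_induct)
  case (snoc p \<Delta>)
  obtain x A where "p = (x, A)" by fastforce
  with snoc.prems have "cwf Ax Rl ((\<Gamma> @ \<Delta>) @ [(x, A)])" by simp
  then obtain s where "cty Ax Rl (\<Gamma> @ \<Delta>) A (CSort s)" by (rule cwf_snoc)
  then show ?case using snoc.IH cty_cwf by blast
qed simp

text \<open>
  Weakening is needed twice: along inclusions, and then along \<open>subenv\<close>, whose variable case needs
  the former to type the types of the target environment.
\<close>

lemma weakening_general:
  assumes snoc: "\<And>\<Gamma> \<Delta> p. E \<Gamma> \<Delta> \<Longrightarrow> E (\<Gamma> @ [p]) (\<Delta> @ [p])"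
    and ren: "\<And>\<rho> \<Gamma> \<Delta>. inj \<rho> \<Longrightarrow> E \<Gamma> \<Delta> \<Longrightarrow> E (renv \<rho> \<Gamma>) (renv \<rho> \<Delta>)"
    and subenv: "\<And>\<Gamma> \<Delta>. E \<Gamma> \<Delta> \<Longrightarrow> subenv \<Gamma> \<Delta>"
    and lookup: "\<And>\<Gamma> \<Delta> x A l B. E \<Gamma> \<Delta> \<Longrightarrow> cwf Ax Rl \<Delta> \<Longrightarrow> (x, A) \<in> set \<Gamma> \<Longrightarrow> lty Ax Rl \<Delta> A l B \<Longrightarrow>
      \<exists>A'. (x, A') \<in> set \<Delta> \<and> lty Ax Rl \<Delta> A' l B"
  shows "cwf Ax Rl \<Gamma> \<Longrightarrow> True"
    and "cty Ax Rl \<Gamma> M A \<Longrightarrow> E \<Gamma> \<Delta> \<Longrightarrow> cwf Ax Rl \<Delta> \<Longrightarrow> cty Ax Rl \<Delta> M A"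
    and "lty Ax Rl \<Gamma> A l B \<Longrightarrow> E \<Gamma> \<Delta> \<Longrightarrow> cwf Ax Rl \<Delta> \<Longrightarrow> lty Ax Rl \<Delta> A l B"
proof (induction arbitrary: and \<Delta> and \<Delta> rule: cwf_cty_lty.inducts)
  case (cty_pi \<Gamma> A s1 x B s2 s3)
  have pi: "cty Ax Rl \<Gamma> (cpi x A B) (CSort s3)"
    using cwf_cty_lty.cty_pi cty_pi by metis
  have x: "x \<notin> fst ` set \<Gamma>"
    using cty_cwf[OF \<open>cty Ax Rl (\<Gamma> @ [(x, A)]) B (CSort s2)\<close>] by (rule cwf_snoc)
  have fresh: "cty Ax Rl \<Delta> (cpi x A B) (CSort s3)"
    if E: "E \<Gamma> \<Delta>" "cwf Ax Rl \<Delta>" and x: "x \<notin> fst ` set \<Delta>" for \<Delta>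
  proof -
    have A: "cty Ax Rl \<Delta> A (CSort s1)" using cty_pi E by blast
    then have "cwf Ax Rl (\<Delta> @ [(x, A)])" using x by (rule cwf_ext)
    with cty_pi snoc[OF E(1)] have "cty Ax Rl (\<Delta> @ [(x, A)]) B (CSort s2)" by blast
    with A show ?thesis using \<open>(s1, s2, s3) \<in> Rl\<close> by (rule cwf_cty_lty.cty_pi)
  qed
  show ?case
    by (rule wlog_fresh_binder[where E = E,
          OF typing_scoped(1)[OF cty_cwf[OF pi]] x cty_cfv[OF pi] cty_cfv_type[OF pi]
            cty_pi.prems(1,2) ren fresh])
next
  case (cty_lam \<Gamma> x A B s M)
  have lam: "cty Ax Rl \<Gamma> (clam x A M) (cpi x A B)"
    using cwf_cty_lty.cty_lam cty_lam by metis
  have wf: "cwf Ax Rl (\<Gamma> @ [(x, A)])"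
    using cty_cwf[OF \<open>cty Ax Rl (\<Gamma> @ [(x, A)]) M B\<close>] .
  then have x: "x \<notin> fst ` set \<Gamma>" by (rule cwf_snoc)
  have fresh: "cty Ax Rl \<Delta> (clam x A M) (cpi x A B)"
    if E: "E \<Gamma> \<Delta>" "cwf Ax Rl \<Delta>" and x: "x \<notin> fst ` set \<Delta>" for \<Delta>
  proof -
    have pi: "cty Ax Rl \<Delta> (cpi x A B) (CSort s)" using cty_lam E by blast
    \<comment> \<open>The rule \<open>cty_lam\<close> has no premise for \<open>A\<close> alone, so
      a sort for \<open>A\<close> over \<open>\<Delta>\<close> is read off the weakened
      product.\<close>
    obtain s1 where "cty Ax Rl \<Delta> A (CSort s1)"
      using cty_cpiD[OF pi x] by blast
    then have "cwf Ax Rl (\<Delta> @ [(x, A)])" using x by (rule cwf_ext)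
    with cty_lam snoc[OF E(1)] have "cty Ax Rl (\<Delta> @ [(x, A)]) M B" by blast
    with pi show ?thesis by (rule cwf_cty_lty.cty_lam)
  qed
  show ?case
    by (rule wlog_fresh_binder[where E = E,
          OF typing_scoped(1)[OF cty_cwf[OF lam]] x cty_cfv[OF lam] cty_cfv_type[OF lam]
            cty_lam.prems(1,2) ren fresh])
next
  case (cty_var \<Gamma> A l B x)
  then have "lty Ax Rl \<Delta> A l B" by blast
  then obtain A' where "(x, A') \<in> set \<Delta>" "lty Ax Rl \<Delta> A' l B"
    using lookup cty_var by meson
  then show ?case by (rule cwf_cty_lty.cty_var[rotated])
next
  case (lty_sub \<Gamma> P A x \<Delta>1 B l C \<Delta>')
  \<comment> \<open>The substitution rules have weakening built in: their target is any larger
    environment, so transitivity replaces an appeal to the hypotheses over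
    \<open>\<Delta>'\<close>.\<close>
  have "subenv (\<Gamma> @ esub P x A \<Delta>1) \<Delta>"
    using subenv_trans[OF _ subenv] lty_sub by blast
  from cwf_cty_lty.lty_sub[OF _ _ this \<open>cwf Ax Rl \<Delta>\<close>] lty_sub show ?case by blast
next
  case (cty_sub \<Gamma> P A x \<Delta>1 M C \<Delta>' C')
  have "subenv (\<Gamma> @ esub P x A \<Delta>1) \<Delta>"
    using subenv_trans[OF _ subenv] cty_sub by blast
  from cwf_cty_lty.cty_sub[OF _ _ this \<open>cwf Ax Rl \<Delta>\<close>] cty_sub show ?case by blast
next
  case (cty_sort \<Gamma> s s')
  then show ?case using cwf_cty_lty.cty_sort[of Ax Rl \<Delta> s s'] by blast
next
  case (lty_nil \<Gamma> A s)
  then show ?case using cwf_cty_lty.lty_nil[of Ax Rl \<Delta> A s] by blast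
next
  case (cty_conv \<Gamma> M A B s)
  then show ?case using cwf_cty_lty.cty_conv[of Ax Rl \<Delta> M A B s] by blast
next
  case (lty_cons \<Gamma> x A B s M l C)
  then show ?case using cwf_cty_lty.lty_cons[of Ax Rl \<Delta> x A B s M l C] by blast
next
  case (lty_conv_right \<Gamma> C l A B s)
  then show ?case using cwf_cty_lty.lty_conv_right[of Ax Rl \<Delta> C l A B s] by blast
next
  case (lty_conv_left \<Gamma> A l C B s)
  then show ?case using cwf_cty_lty.lty_conv_left[of Ax Rl \<Delta> A l C B s] by blast
next
  case (lty_cat \<Gamma> C l' A l B)
  then show ?case using cwf_cty_lty.lty_cat[of Ax Rl \<Delta> C l' A l B] by blast
next
  case (cty_app \<Gamma> M A l B)
  then show ?case using cwf_cty_lty.cty_app[of Ax Rl \<Delta> M A l B] by blast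
qed simp_all

lemma weakening_subset:
  assumes "cty Ax Rl \<Gamma> M A" "set \<Gamma> \<subseteq> set \<Delta>" "cwf Ax Rl \<Delta>"
  shows "cty Ax Rl \<Delta> M A"
proof (rule weakening_general(2)[where E = "\<lambda>\<Gamma> \<Delta>. set \<Gamma> \<subseteq> set \<Delta>", OF _ _ _ _ assms])
  show "set (renv \<rho> \<Gamma>) \<subseteq> set (renv \<rho> \<Delta>)" if "set \<Gamma> \<subseteq> set \<Delta>"
    for \<rho> and \<Gamma> \<Delta> :: "'a cenv"
    using that by (auto simp: renv_def)
qed (auto intro: subset_subenv)

lemma cwf_lookup:
  assumes "cwf Ax Rl \<Delta>" "(x, A) \<in> set \<Delta>"
  obtains s where "cty Ax Rl \<Delta> A (CSort s)"
proof -
  obtain \<Delta>1 \<Delta>2 where \<Delta>: "\<Delta> = \<Delta>1 @ (x, A) # \<Delta>2"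
    using split_list[OF assms(2)] by blast
  with assms(1) have "cwf Ax Rl ((\<Delta>1 @ [(x, A)]) @ \<Delta>2)" by simp
  then have "cwf Ax Rl (\<Delta>1 @ [(x, A)])" by (rule cwf_prefix)
  then obtain s where "cty Ax Rl \<Delta>1 A (CSort s)" by (rule cwf_snoc)
  then have "cty Ax Rl \<Delta> A (CSort s)"
    by (rule weakening_subset[OF _ _ assms(1)]) (auto simp: \<Delta>)
  then show ?thesis by (rule that)
qed

text \<open>The gap between \<open>A\<close> and \<open>A'\<close> serves the substitution lemma,
  where the list is typed from an explicit substitution of the declared type.\<close>

lemma subenv_lookup:
  assumes "subenv \<Gamma> \<Delta>" "cwf Ax Rl \<Delta>" "(x, A) \<in> set \<Gamma>" "lty Ax Rl \<Delta> A' l B" "cconv A A'"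
  shows "\<exists>D. (x, D) \<in> set \<Delta> \<and> lty Ax Rl \<Delta> D l B"
proof -
  obtain D where D: "(x, D) \<in> set \<Delta>" "cconv A D"
    using assms(1,3) by (auto simp: subenv_def)
  obtain s where "cty Ax Rl \<Delta> D (CSort s)"
    using cwf_lookup[OF assms(2) D(1)] .
  moreover have "cconv A' D"
    using cconv_trans[OF cconv_sym[OF assms(5)] D(2)] .
  ultimately have "lty Ax Rl \<Delta> D l B"
    using lty_conv_left[OF assms(4)] by blast
  then show ?thesis using D(1) by blast
qed

lemma weakening:
  assumes "cty Ax Rl \<Gamma> M A" "subenv \<Gamma> \<Delta>" "cwf Ax Rl \<Delta>"
  shows "cty Ax Rl \<Delta> M A"
proof (rule weakening_general(2)[where E = subenv, OF _ subenv_renv _ _ assms])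
  show "subenv (\<Gamma> @ [p]) (\<Delta> @ [p])" if "subenv \<Gamma> \<Delta>" for \<Gamma> \<Delta> :: "'a cenv" and p
    using subenv_snoc[OF that cconv_refl] by (cases p) blast
qed (assumption | rule subenv_lookup[OF _ _ _ _ cconv_refl])+

section \<open>Typability of types\<close>

text \<open>The exception for sorts in \<open>cty_sub\<close> matters here: a substituted type must
  again be typed by a sort, not by an explicit substitution applied to one.\<close>

lemma cty_csub_sort:
  assumes "cty Ax Rl \<Gamma> P A" "cty Ax Rl (\<Gamma> @ [(x, A)] @ \<Delta>) C (CSort s)"
    "subenv (\<Gamma> @ esub P x A \<Delta>) \<Delta>'" "cwf Ax Rl \<Delta>'"
  shows "cty Ax Rl \<Delta>' (csub P x A C) (CSort s)"
  using assms by (rule cty_sub) simp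

text \<open>Sorts are excluded for terms because a sort need not occur on the left of an axiom. For
  lists both ends are always typable, as \<open>lty_nil\<close> and the conversion rules demand a
  sort.\<close>

lemma type_typable:
  shows "cwf Ax Rl \<Gamma> \<Longrightarrow> True"
    and "cty Ax Rl \<Gamma> M A \<Longrightarrow> A \<notin> range CSort \<longrightarrow> (\<exists>s. cty Ax Rl \<Gamma> A (CSort s))"
    and "lty Ax Rl \<Gamma> A l B \<Longrightarrow> (\<exists>s. cty Ax Rl \<Gamma> A (CSort s)) \<and> (\<exists>s. cty Ax Rl \<Gamma> B (CSort s))"
proof (induction rule: cwf_cty_lty.inducts)
  case (lty_sub \<Gamma> P A x \<Delta> B l C \<Delta>')
  then show ?case using cty_csub_sort[of Ax Rl \<Gamma> P A x \<Delta> _ _ \<Delta>'] by meson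
next
  case (cty_sub \<Gamma> P A x \<Delta> M C \<Delta>' C')
  show ?case
  proof
    assume "C' \<notin> range CSort"
    then have "C \<notin> range CSort" "C' = csub P x A C"
      using \<open>C' = (if C \<in> range CSort then C else csub P x A C)\<close> by (auto split: if_splits)
    then show "\<exists>s. cty Ax Rl \<Delta>' C' (CSort s)"
      using cty_sub cty_csub_sort[of Ax Rl \<Gamma> P A x \<Delta> C _ \<Delta>'] by meson
  qed
next
  case (lty_cons \<Gamma> x A B s M l C)
  then show ?case by meson
qed (simp_all, meson+)

section \<open>Extending an argument list\<close>

lemma trargs_eq_LNil [simp]: "trargs ts = LNil \<longleftrightarrow> ts = []" "LNil = trargs ts \<longleftrightarrow> ts = []"
  and trargs_eq_LCons: "LCons M l = trargs ts \<longleftrightarrow> (\<exists>u us. ts = u # us \<and> M = tr u \<and> l = trargs us)"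
  and trargs_neq: "LCat l l' \<noteq> trargs ts" "lsub P x A l \<noteq> trargs ts"
  by (cases ts; auto simp: lsub_def)+

lemma lapp_simps [simp]:
  "lapp [] l = l"
  "lapp (t # ts) l = LCons (tr t) (lapp ts l)"
  by (simp_all add: lapp_def)

lemma lapp_trargs: "lapp us (trargs ts) = trargs (us @ ts)"
  by (induction us) simp_all

text \<open>The rule \<open>lty_cat\<close> would type a \<open>LCat\<close>, which no translation
  contains; instead the derivation of \<open>k\<close> is grafted in place of the final
  \<open>lty_nil\<close>. A conversion on the right of the first list then becomes one on the left
  of \<open>k\<close>, which is possible because the intermediate types are typable.\<close>

lemma lty_lapp:
  assumes "lty Ax Rl \<Gamma> A (trargs ts) B" "lty Ax Rl \<Gamma> B k C"
  shows "lty Ax Rl \<Gamma> A (lapp ts k) C"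
proof -
  have "lty Ax Rl \<Gamma> A l B \<Longrightarrow>
      \<forall>ts. l = trargs ts \<longrightarrow> lty Ax Rl \<Gamma> B k C \<longrightarrow> lty Ax Rl \<Gamma> A (lapp ts k) C" for l
  proof (induction rule: cwf_cty_lty.inducts(3)[of _ _ _ _ _ _ "\<lambda>_. True" "\<lambda>_ _ _. True"])
    case (lty_cons \<Gamma> x A B s M l D)
    show ?case
    proof (intro allI impI)
      fix ts assume ts: "LCons M l = trargs ts" and k: "lty Ax Rl \<Gamma> D k C"
      then obtain u us where "ts = u # us" "M = tr u" "l = trargs us"
        by (auto simp: trargs_eq_LCons)
      then show "lty Ax Rl \<Gamma> (cpi x A B) (lapp ts k) C"
        using lty_cons k cwf_cty_lty.lty_cons[of Ax Rl \<Gamma> x A B s M "lapp us k" C] by simp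
    qed
  next
    case (lty_conv_right \<Gamma> E l A B s)
    show ?case
    proof (intro allI impI)
      fix ts assume ts: "l = trargs ts" and k: "lty Ax Rl \<Gamma> B k C"
      obtain s' where "cty Ax Rl \<Gamma> A (CSort s')"
        using type_typable(3)[OF \<open>lty Ax Rl \<Gamma> E l A\<close>] by blast
      then have "lty Ax Rl \<Gamma> A k C"
        using lty_conv_left[OF k] cconv_sym[OF \<open>cconv A B\<close>] by blast
      then show "lty Ax Rl \<Gamma> E (lapp ts k) C" using lty_conv_right ts by blast
    qed
  next
    case (lty_conv_left \<Gamma> A l D B s)
    then show ?case
      using cwf_cty_lty.lty_conv_left[OF _ \<open>cty Ax Rl \<Gamma> B (CSort s)\<close> \<open>cconv A B\<close>] by blast
  qed (simp_all add: trargs_neq)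
  then show ?thesis using assms by blast
qed

text \<open>Above \<open>lty_nil\<close>, a derivation of the empty list is a chain of conversions,
  and these can be performed on the type of \<open>M\<close> instead.\<close>

lemma lty_LNilD:
  assumes "lty Ax Rl \<Gamma> A LNil B" "cty Ax Rl \<Gamma> M A"
  shows "cty Ax Rl \<Gamma> M B"
proof -
  have "lty Ax Rl \<Gamma> A l B \<Longrightarrow> l = LNil \<longrightarrow> cty Ax Rl \<Gamma> M A \<longrightarrow> cty Ax Rl \<Gamma> M B" for l
  proof (induction rule: cwf_cty_lty.inducts(3)[of _ _ _ _ _ _ "\<lambda>_. True" "\<lambda>_ _ _. True"])
    case (lty_conv_right \<Gamma> E l A B s)
    then show ?case using cty_conv[of Ax Rl \<Gamma> M A B s] by blast
  next
    case (lty_conv_left \<Gamma> A l D B s)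
    obtain s' where "cty Ax Rl \<Gamma> A (CSort s')"
      using type_typable(3)[OF \<open>lty Ax Rl \<Gamma> A l D\<close>] by blast
    then show ?case
      using lty_conv_left cty_conv[of Ax Rl \<Gamma> M B A s'] cconv_sym by blast
  qed (simp_all add: lsub_def)
  then show ?thesis using assms by blast
qed

section \<open>Shapes of translated terms\<close>

lemma spine:
  obtains h us where "t = papps h us" "\<And>t u. h \<noteq> PApp t u"
proof -
  have "\<exists>h us. t = papps h us \<and> (\<forall>t u. h \<noteq> PApp t u)"
  proof (induction t)
    case (PApp t u)
    then obtain h us where "t = papps h us" "\<forall>t u. h \<noteq> PApp t u" by blast
    then show ?case by (metis papps_simps(3))
  next
    case (PVar x)
    then show ?case by (intro exI[of _ "PVar x"] exI[of _ "[]"]) simp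
  next
    case (PSort x)
    then show ?case by (intro exI[of _ "PSort x"] exI[of _ "[]"]) simp
  next
    case (PPi T U)
    then show ?case by (intro exI[of _ "PPi T U"] exI[of _ "[]"]) simp
  next
    case (PLam T U)
    then show ?case by (intro exI[of _ "PLam T U"] exI[of _ "[]"]) simp
  qed
  then show ?thesis using that by blast
qed

lemma neutral_papps: "neutral (papps h us) \<longleftrightarrow> us \<noteq> [] \<or> neutral h"
  by (cases us rule: rev_cases) auto

lemma tr_papps_neutral: "us \<noteq> [] \<or> neutral h \<Longrightarrow> tr (papps h us) = trl (trargs us) h"
  using trl_LNil_neutral[of "papps h us"] by (simp add: neutral_papps trl_papps lapp_LNil)

text \<open>\<open>tr\<close> collapses a whole application spine into one PTSC constructor, so the
  case analysis is by the head and the full argument list rather than by the outermost constructor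
  of \<open>t\<close>.\<close>

lemma tr_cases:
  obtains (var) x us where "t = papps (PVar x) us" "tr t = CVar x (trargs us)"
  | (app) h us where "t = papps h us" "us \<noteq> []" "\<not> neutral h" "tr t = CApp (tr h) (trargs us)"
  | (other) "\<not> neutral t"
proof -
  obtain h us where t: "t = papps h us" and h: "\<And>t u. h \<noteq> PApp t u"
    using spine by blast
  show thesis
  proof (cases "neutral h")
    case True
    with h obtain x where "h = PVar x" by (cases h) auto
    then show ?thesis using var t tr_papps_neutral[of us h] by simp
  next
    case False
    then show ?thesis using app[of h us] other t tr_papps_neutral[of us h]
      by (cases "us = []") (auto simp: trl_not_neutral)
  qed
qed

lemma cty_papps:
  assumes t: "cty Ax Rl \<Gamma> (tr t) A" and ts: "lty Ax Rl \<Gamma> A (trargs ts) B"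
  shows "cty Ax Rl \<Gamma> (tr (papps t ts)) B"
proof (cases t rule: tr_cases)
  case (var x us)
  obtain D where D: "(x, D) \<in> set \<Gamma>" "lty Ax Rl \<Gamma> D (trargs us) A"
    using cty_CVarD[OF t[unfolded var(2)]] .
  have "papps t ts = papps (PVar x) (us @ ts)"
    by (simp add: var(1) papps_def)
  then have "tr (papps t ts) = CVar x (trargs (us @ ts))"
    using tr_papps_neutral[of "us @ ts" "PVar x"] by simp
  then show ?thesis
    using cty_var[OF lty_lapp[OF D(2) ts] D(1)] by (simp add: lapp_trargs)
next
  case (app h us)
  obtain D where D: "cty Ax Rl \<Gamma> (tr h) D" "lty Ax Rl \<Gamma> D (trargs us) A"
    using cty_CAppD[OF t[unfolded app(4)]] .
  have "papps t ts = papps h (us @ ts)"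
    by (simp add: app(1) papps_def)
  then have "tr (papps t ts) = CApp (tr h) (trargs (us @ ts))"
    using tr_papps_neutral[of "us @ ts" h] app by (simp add: trl_not_neutral)
  then show ?thesis
    using cty_app[OF D(1) lty_lapp[OF D(2) ts]] by (simp add: lapp_trargs)
next
  case other
  show ?thesis
  \<comment> \<open>With no argument the translation is \<open>tr t\<close> itself, not
    \<open>CApp (tr t) LNil\<close>, so the conversions hidden in the list derivation have to be
    moved to \<open>tr t\<close>.\<close>
  proof (cases "ts = []")
    case True
    then show ?thesis using lty_LNilD t ts by fastforce
  next
    case False
    then have "tr (papps t ts) = CApp (tr t) (trargs ts)"
      using tr_papps_neutral[of ts t] other by (simp add: trl_not_neutral)
    then show ?thesis using cty_app[OF t ts] by simp
  qed
qed

lemma tr_eq_CSort: "tr t = CSort s \<Longrightarrow> t = PSort s"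
  by (cases t rule: tr_cases; cases t) auto

lemma tr_eq_cpi:
  assumes "tr t = cpi y A B"
  obtains T U where "t = ppi y T U" "A = tr T" "B = tr U"
proof -
  obtain T b where t: "t = PPi T b"
    using assms by (cases t rule: tr_cases; cases t) (auto simp: cpi_def)
  with assms have b: "A = tr T" "tr b = cren (bindr y) B" by (simp_all add: cpi_def)
  \<comment> \<open>\<open>b\<close> itself is not given as an abstraction over \<open>y\<close>;
    comparing free variables shows that it misses the index \<open>Suc y\<close> and hence is
    one.\<close>
  have "pfv b = bindr y ` cfv B"
    using b(2) by (metis cfv_lfv_tr(1) cfv_lfv_ren(1))
  then have "Suc y \<notin> pfv b" by (auto simp: bindr_def)
  then have "t = ppi y T (pren (unbindr y) b)"
    by (simp add: t ppi_def pren_bindr_unbindr)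
  moreover have "B = tr (pren (unbindr y) b)"
    by (simp add: tr_trl_pren b(2) cren_unbindr_bindr)
  ultimately show ?thesis using that b(1) by blast
qed

lemma tr_eq_clam:
  assumes "tr t = clam y A B"
  obtains T U where "t = plam y T U" "A = tr T" "B = tr U"
proof -
  obtain T b where t: "t = PLam T b"
    using assms by (cases t rule: tr_cases; cases t) (auto simp: clam_def)
  with assms have b: "A = tr T" "tr b = cren (bindr y) B" by (simp_all add: clam_def)
  have "pfv b = bindr y ` cfv B"
    using b(2) by (metis cfv_lfv_tr(1) cfv_lfv_ren(1))
  then have "Suc y \<notin> pfv b" by (auto simp: bindr_def)
  then have "t = plam y T (pren (unbindr y) b)"
    by (simp add: t plam_def pren_bindr_unbindr)
  moreover have "B = tr (pren (unbindr y) b)"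
    by (simp add: tr_trl_pren b(2) cren_unbindr_bindr)
  ultimately show ?thesis using that b(1) by blast
qed

lemma tr_eq_CVar:
  assumes "tr t = CVar x l"
  obtains us where "t = papps (PVar x) us" "l = trargs us"
  using assms by (cases t rule: tr_cases; cases t) auto

lemma tr_eq_CApp:
  assumes "tr t = CApp M l"
  obtains h us where "t = papps h us" "M = tr h" "l = trargs us"
  using assms by (cases t rule: tr_cases; cases t) auto

lemma tr_neq_csub: "tr t \<noteq> csub N x A M"
  by (cases t rule: tr_cases; cases t) (auto simp: csub_def)

section \<open>The substitution lemma\<close>

text \<open>The side conditions of the substitution rules. The target \<open>\<Delta>'\<close> is
  kept arbitrary, as in those rules, so that below a binder it can be extended by any type
  convertible to the explicit substitution, in particular by the translation of the implicit
  one.\<close>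

definition subst_env ::
  "('s \<times> 's) set \<Rightarrow> ('s \<times> 's \<times> 's) set \<Rightarrow> 's cenv \<Rightarrow> 's cterm \<Rightarrow> name \<Rightarrow> 's cterm \<Rightarrow> 's cenv \<Rightarrow> 's cenv \<Rightarrow> bool"
where
  "subst_env Ax Rl \<Gamma> P x A \<Delta> \<Delta>' \<longleftrightarrow> cty Ax Rl \<Gamma> P A \<and> cwf Ax Rl (\<Gamma> @ [(x, A)] @ \<Delta>) \<and>
    subenv (\<Gamma> @ esub P x A \<Delta>) \<Delta>' \<and> cwf Ax Rl \<Delta>'"

lemma esub_simps [simp]:
  "esub P x A [] = []"
  "esub P x A (\<Delta> @ \<Delta>') = esub P x A \<Delta> @ esub P x A \<Delta>'"
  "esub P x A ((y, B) # \<Delta>) = (y, csub P x A B) # esub P x A \<Delta>"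
  by (simp_all add: esub_def)

lemma subst_env_snoc:
  assumes E: "subst_env Ax Rl \<Gamma> P x A \<Delta> \<Delta>'"
    and B: "cwf Ax Rl (\<Gamma> @ [(x, A)] @ \<Delta> @ [(y, B)])"
    and B': "cty Ax Rl \<Delta>' B' (CSort s)" "y \<notin> fst ` set \<Delta>'" "cconv (csub P x A B) B'"
  shows "subst_env Ax Rl \<Gamma> P x A (\<Delta> @ [(y, B)]) (\<Delta>' @ [(y, B')])"
proof -
  have "subenv ((\<Gamma> @ esub P x A \<Delta>) @ [(y, csub P x A B)]) (\<Delta>' @ [(y, B')])"
    using E B'(3) by (intro subenv_snoc) (simp_all add: subst_env_def)
  then show ?thesis
    using E B cwf_ext[OF B'(1,2)] by (simp add: subst_env_def)
qed

lemma subst_env_csub_sort: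
  assumes "subst_env Ax Rl \<Gamma> P x A \<Delta> \<Delta>'" "cty Ax Rl (\<Gamma> @ [(x, A)] @ \<Delta>) C (CSort s)"
  shows "cty Ax Rl \<Delta>' (csub P x A C) (CSort s)"
  using assms by (intro cty_csub_sort) (auto simp: subst_env_def)

lemma cconv_csub_type: "cconv (if C \<in> range CSort then C else csub P x A C) (csub P x A C)"
proof (cases "C \<in> range CSort")
  case True
  then obtain s where "C = CSort s" by blast
  then show ?thesis using cconv_sym[OF cconv_red[OF s_sort]] by simp
qed simp

lemma subst_env_to_csub:
  assumes "subst_env Ax Rl \<Gamma> P x A \<Delta> \<Delta>'" "cty Ax Rl (\<Gamma> @ [(x, A)] @ \<Delta>) C (CSort s)"
    and "cty Ax Rl \<Delta>' N (if C \<in> range CSort then C else csub P x A C)"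
  shows "cty Ax Rl \<Delta>' N (csub P x A C)"
  using assms(3) subst_env_csub_sort[OF assms(1,2)] cconv_csub_type by (rule cty_conv)

text \<open>Converting back to a sort requires that sort to be typable over
  \<open>\<Delta>'\<close>: its derivation over the source environment reveals an axiom, which
  applies in every well-formed environment.\<close>

lemma subst_env_from_csub:
  assumes "subst_env Ax Rl \<Gamma> P x A \<Delta> \<Delta>'" "cty Ax Rl (\<Gamma> @ [(x, A)] @ \<Delta>) C (CSort s)"
    and "cty Ax Rl \<Delta>' N (csub P x A C)"
  shows "cty Ax Rl \<Delta>' N (if C \<in> range CSort then C else csub P x A C)"
proof (cases "C \<in> range CSort")
  case True
  then obtain s0 where s0: "C = CSort s0" by blast
  moreover have "cwf Ax Rl \<Delta>'" using assms(1) by (simp add: subst_env_def)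
  ultimately obtain s' where "cty Ax Rl \<Delta>' C (CSort s')"
    using assms(2) cty_CSort_cwf by metis
  then have "cty Ax Rl \<Delta>' N C"
    using assms(3) s0 cty_conv cconv_red[OF s_sort] by metis
  then show ?thesis using True by simp
qed (use assms in simp)

lemma cwf_distinct: "cwf Ax Rl \<Gamma> \<Longrightarrow> distinct (map fst \<Gamma>)"
proof (induction \<Gamma> rule: rev_induct)
  case (snoc p \<Gamma>)
  obtain x A where p: "p = (x, A)" by fastforce
  with snoc.prems obtain s where "cty Ax Rl \<Gamma> A (CSort s)" "x \<notin> fst ` set \<Gamma>"
    using cwf_snoc by metis
  then show ?case using snoc.IH cty_cwf by (fastforce simp: p)
qed simp

lemma scoped_esub:
  assumes "scoped (\<Gamma> @ [(x, A)] @ \<Delta>)" "scoped \<Gamma>" "cfv A \<subseteq> fst ` set \<Gamma>" "cfv P \<subseteq> fst ` set \<Gamma>"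
  shows "scoped (\<Gamma> @ esub P x A \<Delta>)"
proof -
  have dom: "fst ` set (\<Gamma> @ esub P x A \<Delta>) = fst ` set \<Gamma> \<union> fst ` set \<Delta>"
    by (simp add: image_Un)
  show ?thesis
    unfolding scoped_def dom
  proof (intro ballI, clarify)
    fix z B w
    assume "(z, B) \<in> set (\<Gamma> @ esub P x A \<Delta>)" and w: "w \<in> cfv B" and "w \<notin> fst ` set \<Delta>"
    then consider "(z, B) \<in> set \<Gamma>" | D where "(z, D) \<in> set \<Delta>" "B = csub P x A D"
      by (auto simp: esub_def)
    then show "w \<in> fst ` set \<Gamma>"
    proof cases
      case 1
      then show ?thesis using assms(2) w by (auto simp: scoped_def)
    next
      case 2
      then have "cfv D \<subseteq> fst ` set (\<Gamma> @ [(x, A)] @ \<Delta>)" using assms(1) unfolding scoped_def by fastforce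
      then have "cfv D \<subseteq> insert x (fst ` set \<Gamma> \<union> fst ` set \<Delta>)" by auto
      then show ?thesis using w assms(3,4) \<open>w \<notin> fst ` set \<Delta>\<close> unfolding 2(2) cfv_csub by blast
    qed
  qed
qed

lemma subst_env_ctxt:
  assumes "subst_env Ax Rl \<Gamma> P x A \<Delta> \<Delta>'"
  shows "x \<notin> fst ` set \<Gamma>" "x \<notin> cfv A" "cfv P \<subseteq> fst ` set \<Gamma>" "cfv A \<subseteq> fst ` set \<Gamma>"
    and "subenv \<Gamma> \<Delta>'" "\<exists>s. cty Ax Rl \<Gamma> A (CSort s)" "scoped (\<Gamma> @ esub P x A \<Delta>)"
    and "\<And>B. (x, B) \<in> set (\<Gamma> @ [(x, A)] @ \<Delta>) \<Longrightarrow> B = A"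
proof -
  have wf: "cwf Ax Rl (\<Gamma> @ [(x, A)] @ \<Delta>)" and P: "cty Ax Rl \<Gamma> P A"
    using assms by (simp_all add: subst_env_def)
  have wfA: "cwf Ax Rl (\<Gamma> @ [(x, A)])"
    using cwf_prefix[of Ax Rl "\<Gamma> @ [(x, A)]" \<Delta>] wf by simp
  then obtain s where A: "cty Ax Rl \<Gamma> A (CSort s)" and x: "x \<notin> fst ` set \<Gamma>"
    by (rule cwf_snoc)
  show "x \<notin> fst ` set \<Gamma>" "cfv P \<subseteq> fst ` set \<Gamma>" "\<exists>s. cty Ax Rl \<Gamma> A (CSort s)"
    using x cty_cfv[OF P] A by blast+
  show fvA: "cfv A \<subseteq> fst ` set \<Gamma>" using cty_cfv[OF A] .
  then show "x \<notin> cfv A" using x by blast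
  show "subenv \<Gamma> \<Delta>'" using assms by (auto simp: subst_env_def subenv_def)
  have "scoped (\<Gamma> @ [(x, A)] @ \<Delta>)" using typing_scoped(1)[OF wf] .
  moreover have "scoped \<Gamma>" using typing_scoped(1)[OF cty_cwf[OF A]] .
  ultimately show "scoped (\<Gamma> @ esub P x A \<Delta>)"
    using fvA cty_cfv[OF P] by (rule scoped_esub)
  show "B = A" if "(x, B) \<in> set (\<Gamma> @ [(x, A)] @ \<Delta>)" for B
    using eq_key_imp_eq_value[OF cwf_distinct[OF wf] that] by simp
qed

text \<open>Scoping of \<open>\<Gamma> @ esub (tr u) x A \<Delta>\<close> is all that the swapping
  argument asks of this environment, so its well-formedness need not be established. Only
  \<open>\<Delta>'\<close> can contain \<open>y\<close>, and only \<open>\<Delta>'\<close>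
  changes.\<close>

lemma subst_env_wlog:
  assumes E: "subst_env Ax Rl \<Gamma> (tr u) x A \<Delta> \<Delta>'"
    and y: "y \<notin> fst ` set (\<Gamma> @ [(x, A)] @ \<Delta>)"
    and t: "pfv t \<subseteq> fst ` set (\<Gamma> @ [(x, A)] @ \<Delta>)"
    and C: "cfv C \<subseteq> fst ` set (\<Gamma> @ esub (tr u) x A \<Delta>)"
    and fresh: "\<And>\<Delta>'. subst_env Ax Rl \<Gamma> (tr u) x A \<Delta> \<Delta>' \<Longrightarrow> y \<notin> fst ` set \<Delta>' \<Longrightarrow>
      cty Ax Rl \<Delta>' (tr (psubst x u t)) C"
  shows "cty Ax Rl \<Delta>' (tr (psubst x u t)) C"
proof (rule wlog_fresh_binder[where E = subenv, OF _ _ _ _ _ _ subenv_renv])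
  have dom: "fst ` set (\<Gamma> @ esub (tr u) x A \<Delta>) = fst ` set \<Gamma> \<union> fst ` set \<Delta>"
    by (simp add: image_Un)
  show "scoped (\<Gamma> @ esub (tr u) x A \<Delta>)" by (rule subst_env_ctxt(7)[OF E])
  show "y \<notin> fst ` set (\<Gamma> @ esub (tr u) x A \<Delta>)" using y unfolding dom by auto
  have "pfv t \<subseteq> insert x (fst ` set \<Gamma> \<union> fst ` set \<Delta>)" using t by auto
  moreover have "pfv u \<subseteq> fst ` set \<Gamma>"
    using subst_env_ctxt(3)[OF E] by (simp add: cfv_lfv_tr)
  ultimately show "cfv (tr (psubst x u t)) \<subseteq> fst ` set (\<Gamma> @ esub (tr u) x A \<Delta>)"
    using pfv_psubst[of x u t] unfolding cfv_lfv_tr dom by blast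
  show "cfv C \<subseteq> fst ` set (\<Gamma> @ esub (tr u) x A \<Delta>)" by (rule C)
  show "subenv (\<Gamma> @ esub (tr u) x A \<Delta>) \<Delta>'" "cwf Ax Rl \<Delta>'"
    using E by (simp_all add: subst_env_def)
  show "cty Ax Rl \<Delta>'' (tr (psubst x u t)) C"
    if "subenv (\<Gamma> @ esub (tr u) x A \<Delta>) \<Delta>''" "cwf Ax Rl \<Delta>''" "y \<notin> fst ` set \<Delta>''" for \<Delta>''
    using fresh that E by (simp add: subst_env_def)
qed

text \<open>
  The second part of the statement for terms carries the induction hypothesis for the domain of a
  product to the rule \<open>cty_lam\<close>, where the domain is typed only inside the derivation of the product.
\<close>

lemma subst_typing:
  fixes \<Gamma> :: "'s cenv" and u x A
  defines "S \<equiv> csub (tr u) x A"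
  defines "ty \<equiv> \<lambda>C. if C \<in> range CSort then C else S C"
  shows "cwf Ax Rl \<Theta> \<Longrightarrow> True"
    and "cty Ax Rl \<Theta> M C \<Longrightarrow> \<Theta> = \<Gamma> @ [(x, A)] @ \<Delta> \<Longrightarrow> subst_env Ax Rl \<Gamma> (tr u) x A \<Delta> \<Delta>' \<Longrightarrow>
      (\<forall>t. M = tr t \<longrightarrow> cty Ax Rl \<Delta>' (tr (psubst x u t)) (ty C)) \<and>
      (\<forall>z T B. M = cpi z (tr T) B \<longrightarrow> z \<notin> fst ` set \<Theta> \<longrightarrow>
        (\<exists>s1 s2 s3. (s1, s2, s3) \<in> Rl \<and> cty Ax Rl \<Delta>' (tr (psubst x u T)) (CSort s1) \<and>
          cty Ax Rl (\<Theta> @ [(z, tr T)]) B (CSort s2)))"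
    and "lty Ax Rl \<Theta> B l C \<Longrightarrow> \<Theta> = \<Gamma> @ [(x, A)] @ \<Delta> \<Longrightarrow> subst_env Ax Rl \<Gamma> (tr u) x A \<Delta> \<Delta>' \<Longrightarrow>
      \<forall>ts. l = trargs ts \<longrightarrow> lty Ax Rl \<Delta>' (S B) (trargs (map (psubst x u) ts)) (S C)"
proof (induction arbitrary: and \<Delta> \<Delta>' and \<Delta> \<Delta>' rule: cwf_cty_lty.inducts)
  case (cty_sort \<Theta> s s')
  have "cwf Ax Rl \<Delta>'" using cty_sort.prems by (simp add: subst_env_def)
  then have "cty Ax Rl \<Delta>' (CSort s) (CSort s')"
    using \<open>(s, s') \<in> Ax\<close> by (rule cwf_cty_lty.cty_sort)
  then show ?case by (auto simp: ty_def psubst_def dest!: tr_eq_CSort[OF sym])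
next
  case (cty_pi \<Theta> B s1 y D s2 s3)
  note \<Theta> = \<open>\<Theta> = \<Gamma> @ [(x, A)] @ \<Delta>\<close> and E = \<open>subst_env Ax Rl \<Gamma> (tr u) x A \<Delta> \<Delta>'\<close>
  have B: "cty Ax Rl \<Theta> B (CSort s1)" and D: "cty Ax Rl (\<Theta> @ [(y, B)]) D (CSort s2)"
    and R: "(s1, s2, s3) \<in> Rl"
    using cty_pi by blast+
  have y: "y \<notin> fst ` set \<Theta>" using cty_cwf[OF D] by (rule cwf_snoc)
  have "cty Ax Rl \<Delta>' (tr (psubst x u t)) (CSort s3)" if t: "cpi y B D = tr t" for t
  proof -
    obtain T U where TU: "t = ppi y T U" "B = tr T" "D = tr U"
      using tr_eq_cpi[OF t[symmetric]] .
    have yu: "y \<noteq> x" "y \<notin> pfv u"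
      using y subst_env_ctxt(3)[OF E] by (auto simp: \<Theta> cfv_lfv_tr)
    show ?thesis
    proof (rule subst_env_wlog[OF E])
      show "y \<notin> fst ` set (\<Gamma> @ [(x, A)] @ \<Delta>)" using y \<Theta> by simp
      have "cty Ax Rl \<Theta> (tr t) (CSort s3)"
        using cwf_cty_lty.cty_pi[OF B D R] t by simp
      from cty_cfv[OF this] show "pfv t \<subseteq> fst ` set (\<Gamma> @ [(x, A)] @ \<Delta>)"
        by (simp add: cfv_lfv_tr \<Theta>)
      fix \<Delta>'' assume E': "subst_env Ax Rl \<Gamma> (tr u) x A \<Delta> \<Delta>''" and y': "y \<notin> fst ` set \<Delta>''"
      have T': "cty Ax Rl \<Delta>'' (tr (psubst x u T)) (CSort s1)"
        using cty_pi.IH(2)[OF \<Theta> E'] TU(2) by (simp add: ty_def)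
      \<comment> \<open>Extending the target by the implicit substitution of the domain lets
        \<open>cty_pi\<close> produce a translated product; \<open>csub_tr\<close> supplies the
        required conversion.\<close>
      have "subst_env Ax Rl \<Gamma> (tr u) x A (\<Delta> @ [(y, B)]) (\<Delta>'' @ [(y, tr (psubst x u T))])"
        using subst_env_snoc[OF E' _ T' y' csub_tr] cty_cwf[OF D] by (simp add: \<Theta> TU(2))
      from cty_pi.IH(4)[OF _ this]
      have "cty Ax Rl (\<Delta>'' @ [(y, tr (psubst x u T))]) (tr (psubst x u U)) (CSort s2)"
        by (simp add: \<Theta> TU(3) ty_def)
      from cwf_cty_lty.cty_pi[OF T' this R] show "cty Ax Rl \<Delta>'' (tr (psubst x u t)) (CSort s3)"
        by (simp add: TU(1) psubst_ppi[OF yu] tr_ppi)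
    qed simp
  qed
  moreover have "\<exists>s1 s2 s3. (s1, s2, s3) \<in> Rl \<and> cty Ax Rl \<Delta>' (tr (psubst x u T)) (CSort s1) \<and>
      cty Ax Rl (\<Theta> @ [(z, tr T)]) B' (CSort s2)"
    if eq: "cpi y B D = cpi z (tr T) B'" and z: "z \<notin> fst ` set \<Theta>" for z T B'
  proof -
    have T: "B = tr T" using eq by (simp add: cpi_def)
    then have "cty Ax Rl \<Delta>' (tr (psubst x u T)) (CSort s1)"
      using cty_pi.IH(2)[OF \<Theta> E] by (simp add: ty_def)
    moreover have "cty Ax Rl (\<Theta> @ [(z, tr T)]) B' (CSort s2)"
      using cty_cpi_body[OF D eq z] T by simp
    ultimately show ?thesis using R by blast
  qed
  ultimately show ?case by (simp add: ty_def)
next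
  case (cty_lam \<Theta> y B D s M)
  note \<Theta> = \<open>\<Theta> = \<Gamma> @ [(x, A)] @ \<Delta>\<close> and E = \<open>subst_env Ax Rl \<Gamma> (tr u) x A \<Delta> \<Delta>'\<close>
  have pi: "cty Ax Rl \<Theta> (cpi y B D) (CSort s)" and M: "cty Ax Rl (\<Theta> @ [(y, B)]) M D"
    using cty_lam by blast+
  have y: "y \<notin> fst ` set \<Theta>" using cty_cwf[OF M] by (rule cwf_snoc)
  have "cty Ax Rl \<Delta>' (tr (psubst x u t)) (S (cpi y B D))" if t: "clam y B M = tr t" for t
  proof -
    obtain T U where TU: "t = plam y T U" "B = tr T" "M = tr U"
      using tr_eq_clam[OF t[symmetric]] .
    have yu: "y \<noteq> x" "y \<notin> cfv (tr u)" "y \<notin> cfv A"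
      using y subst_env_ctxt(3,4)[OF E] by (auto simp: \<Theta>)
    show ?thesis
    proof (rule subst_env_wlog[OF E])
      show "y \<notin> fst ` set (\<Gamma> @ [(x, A)] @ \<Delta>)" using y \<Theta> by simp
      have "cty Ax Rl \<Theta> (tr t) (cpi y B D)"
        using cwf_cty_lty.cty_lam[OF pi M] t by simp
      from cty_cfv[OF this] show "pfv t \<subseteq> fst ` set (\<Gamma> @ [(x, A)] @ \<Delta>)"
        by (simp add: cfv_lfv_tr \<Theta>)
      have dom: "fst ` set (\<Gamma> @ esub (tr u) x A \<Delta>) = fst ` set \<Gamma> \<union> fst ` set \<Delta>"
        by (simp add: image_Un)
      have "cfv (cpi y B D) \<subseteq> insert x (fst ` set \<Gamma> \<union> fst ` set \<Delta>)"
        using cty_cfv[OF pi] by (auto simp: \<Theta>)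
      then show "cfv (S (cpi y B D)) \<subseteq> fst ` set (\<Gamma> @ esub (tr u) x A \<Delta>)"
        using subst_env_ctxt(3,4)[OF E] unfolding S_def cfv_csub dom by blast
      fix \<Delta>'' assume E': "subst_env Ax Rl \<Gamma> (tr u) x A \<Delta> \<Delta>''" and y': "y \<notin> fst ` set \<Delta>''"
      let ?T = "tr (psubst x u T)"
      obtain s1 s2 s3 where R: "(s1, s2, s3) \<in> Rl" and T': "cty Ax Rl \<Delta>'' ?T (CSort s1)"
        and D: "cty Ax Rl (\<Theta> @ [(y, B)]) D (CSort s2)"
        using cty_lam.IH(2)[OF \<Theta> E'] y TU(2) by blast
      have E2: "subst_env Ax Rl \<Gamma> (tr u) x A (\<Delta> @ [(y, B)]) (\<Delta>'' @ [(y, ?T)])"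
        using subst_env_snoc[OF E' _ T' y' csub_tr] cty_cwf[OF D] by (simp add: \<Theta> TU(2))
      have D': "cty Ax Rl (\<Gamma> @ [(x, A)] @ \<Delta> @ [(y, B)]) D (CSort s2)"
        using D by (simp add: \<Theta>)
      have "cty Ax Rl (\<Delta>'' @ [(y, ?T)]) (tr (psubst x u U)) (ty D)"
        using cty_lam.IH(4)[OF _ E2] by (simp add: \<Theta> TU(3))
      then have U': "cty Ax Rl (\<Delta>'' @ [(y, ?T)]) (tr (psubst x u U)) (S D)"
        using subst_env_to_csub[OF E2 D'] unfolding ty_def S_def by blast
      have SD: "cty Ax Rl (\<Delta>'' @ [(y, ?T)]) (S D) (CSort s2)"
        using subst_env_csub_sort[OF E2 D'] unfolding S_def .
      \<comment> \<open>\<open>D\<close> need not be a translation. The product found first is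
        therefore mixed, with an implicit substitution in its domain and an explicit one in its
        codomain, and a conversion leads to \<open>S (cpi y B D)\<close>.\<close>
      have "cty Ax Rl \<Delta>'' (clam y ?T (tr (psubst x u U))) (cpi y ?T (S D))"
        using cwf_cty_lty.cty_lam[OF cwf_cty_lty.cty_pi[OF T' SD R] U'] .
      moreover have "cty Ax Rl \<Delta>'' (S (cpi y B D)) (CSort s)"
        using subst_env_csub_sort[OF E'] pi unfolding S_def \<Theta> by blast
      moreover have "cconv (cpi y ?T (S D)) (S (cpi y B D))"
      proof (rule cconv_sym)
        have "cconv (S (cpi y B D)) (cpi y (S B) (S D))"
          unfolding S_def using yu by (rule cconv_csub_cpi)
        also have "cconv \<dots> (cpi y ?T (S D))"
          unfolding S_def TU(2) by (intro cconv_cpi csub_tr cconv_refl)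
        finally show "cconv (S (cpi y B D)) (cpi y ?T (S D))" .
      qed
      ultimately have "cty Ax Rl \<Delta>'' (clam y ?T (tr (psubst x u U))) (S (cpi y B D))"
        by (rule cwf_cty_lty.cty_conv)
      then show "cty Ax Rl \<Delta>'' (tr (psubst x u t)) (S (cpi y B D))"
        using yu by (simp add: TU(1) psubst_plam tr_plam cfv_lfv_tr)
    qed
  qed
  moreover have "ty (cpi y B D) = S (cpi y B D)" by (auto simp: ty_def)
  ultimately show ?case by simp
next
  case (cty_var \<Theta> B l C z)
  note \<Theta> = \<open>\<Theta> = \<Gamma> @ [(x, A)] @ \<Delta>\<close> and E = \<open>subst_env Ax Rl \<Gamma> (tr u) x A \<Delta> \<Delta>'\<close>
  have l: "lty Ax Rl \<Theta> B l C" and z: "(z, B) \<in> set \<Theta>" using cty_var by blast+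
  have wf': "cwf Ax Rl \<Delta>'" and sub: "subenv (\<Gamma> @ esub (tr u) x A \<Delta>) \<Delta>'" and u: "cty Ax Rl \<Gamma> (tr u) A"
    using E by (simp_all add: subst_env_def)
  obtain s where C: "cty Ax Rl \<Theta> C (CSort s)" using type_typable(3)[OF l] by blast
  have "cty Ax Rl \<Delta>' (tr (psubst x u t)) (S C)" if t: "CVar z l = tr t" for t
  proof -
    obtain us where us: "t = papps (PVar z) us" "l = trargs us"
      using tr_eq_CVar[OF t[symmetric]] .
    let ?us = "map (psubst x u) us"
    have IH: "lty Ax Rl \<Delta>' (S B) (trargs ?us) (S C)"
      using cty_var.IH(2)[OF \<Theta> E] us(2) by blast
    show ?thesis
    proof (cases "z = x")
      case True
      \<comment> \<open>The type of \<open>x\<close> cannot mention \<open>x\<close>, so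
        \<open>S\<close> acts trivially on it up to conversion. The arguments are then appended to
        the spine of \<open>u\<close>.\<close>
      have "B = A" using subst_env_ctxt(8)[OF E] z True \<Theta> by blast
      then have "cconv (S B) A"
        unfolding S_def using csub_fresh[OF subst_env_ctxt(2)[OF E]] by simp
      moreover obtain sA where "cty Ax Rl \<Gamma> A (CSort sA)"
        using subst_env_ctxt(6)[OF E] by blast
      then have "cty Ax Rl \<Delta>' A (CSort sA)"
        using subst_env_ctxt(5)[OF E] wf' by (rule weakening)
      ultimately have "lty Ax Rl \<Delta>' A (trargs ?us) (S C)"
        using lty_conv_left[OF IH] by blast
      with weakening[OF u subst_env_ctxt(5)[OF E] wf']
      have "cty Ax Rl \<Delta>' (tr (papps u ?us)) (S C)" by (rule cty_papps)
      then show ?thesis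
        using True by (simp add: us(1) psubst_papps) (simp add: psubst_def)
    next
      case False
      have "\<exists>D. (z, D) \<in> set \<Delta>' \<and> lty Ax Rl \<Delta>' D (trargs ?us) (S C)"
      \<comment> \<open>A declaration before \<open>x\<close> is not substituted, so
        \<open>S B\<close> is traded for \<open>B\<close> by freshness; one after \<open>x\<close>
        already carries \<open>S B\<close>.\<close>
      proof (cases "(z, B) \<in> set \<Gamma>")
        case True
        have "scoped \<Gamma>" using typing_scoped(1)[OF cty_cwf[OF u]] .
        with True have "cfv B \<subseteq> fst ` set \<Gamma>" by (auto simp: scoped_def)
        then have "cconv B (S B)"
          unfolding S_def using subst_env_ctxt(1)[OF E] by (intro cconv_sym[OF csub_fresh]) blast
        with True show ?thesis
          by (intro subenv_lookup[OF subst_env_ctxt(5)[OF E] wf' _ IH])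
      next
        case False': False
        then have "(z, B) \<in> set \<Delta>" using z False by (auto simp: \<Theta>)
        then have "(z, S B) \<in> set (\<Gamma> @ esub (tr u) x A \<Delta>)"
          by (force simp: esub_def S_def)
        then show ?thesis
          using subenv_lookup[OF sub wf' _ IH cconv_refl] by blast
      qed
      then have "cty Ax Rl \<Delta>' (CVar z (trargs ?us)) (S C)"
        using cwf_cty_lty.cty_var by blast
      moreover have "psubst x u t = papps (PVar z) ?us"
        using False by (simp add: us(1) psubst_papps) (simp add: psubst_def)
      ultimately show ?thesis by (simp add: tr_papps_neutral)
    qed
  qed
  then have "cty Ax Rl \<Delta>' (tr (psubst x u t)) (ty C)" if "CVar z l = tr t" for t
    using subst_env_from_csub[OF E] C that unfolding ty_def S_def \<Theta> by blast
  then show ?case by simp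
next
  case (lty_nil \<Theta> B s)
  then have "cty Ax Rl \<Delta>' (S B) (CSort s)"
    using subst_env_csub_sort unfolding S_def by metis
  then have "lty Ax Rl \<Delta>' (S B) LNil (S B)" by (rule cwf_cty_lty.lty_nil)
  then show ?case by simp
next
  case (cty_conv \<Theta> M B C s)
  note E = \<open>subst_env Ax Rl \<Gamma> (tr u) x A \<Delta> \<Delta>'\<close>
  have IH: "(\<forall>t. M = tr t \<longrightarrow> cty Ax Rl \<Delta>' (tr (psubst x u t)) (ty B)) \<and>
      (\<forall>z T B. M = cpi z (tr T) B \<longrightarrow> z \<notin> fst ` set \<Theta> \<longrightarrow>
        (\<exists>s1 s2 s3. (s1, s2, s3) \<in> Rl \<and> cty Ax Rl \<Delta>' (tr (psubst x u T)) (CSort s1) \<and>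
          cty Ax Rl (\<Theta> @ [(z, tr T)]) B (CSort s2)))"
    using cty_conv by blast
  have C: "cty Ax Rl (\<Gamma> @ [(x, A)] @ \<Delta>) C (CSort s)"
    using \<open>cty Ax Rl \<Theta> C (CSort s)\<close> \<open>\<Theta> = \<Gamma> @ [(x, A)] @ \<Delta>\<close> by simp
  have SC: "cty Ax Rl \<Delta>' (S C) (CSort s)"
    unfolding S_def by (rule subst_env_csub_sort[OF E C])
  have "cconv (ty B) (S B)" unfolding ty_def S_def by (rule cconv_csub_type)
  also have "cconv (S B) (S C)"
    unfolding S_def using \<open>cconv B C\<close> by (intro cconv_csub cconv_refl)
  finally have "cty Ax Rl \<Delta>' (tr (psubst x u t)) (ty C)" if "M = tr t" for t
    using IH that cwf_cty_lty.cty_conv[OF _ SC] subst_env_from_csub[OF E C]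
    unfolding ty_def S_def by blast
  then show ?case using IH by blast
next
  case (lty_cons \<Theta> y B D s M l C)
  note \<Theta> = \<open>\<Theta> = \<Gamma> @ [(x, A)] @ \<Delta>\<close> and E = \<open>subst_env Ax Rl \<Gamma> (tr u) x A \<Delta> \<Delta>'\<close>
  have pi: "cty Ax Rl \<Theta> (cpi y B D) (CSort s)" and M: "cty Ax Rl \<Theta> M B"
    using lty_cons by blast+
  \<comment> \<open>\<open>lty_cons\<close> does not extend the environment, so its binder
    \<open>y\<close> may be declared in \<open>\<Theta>\<close> or \<open>\<Delta>'\<close>. A new
    name \<open>z\<close> allows both to be extended.\<close>
  have "finite (fst ` set \<Theta> \<union> fst ` set \<Delta>' \<union> cfv D)" by (simp add: finite_cfv_lfv)
  then obtain z where z: "z \<notin> fst ` set \<Theta>" "z \<notin> fst ` set \<Delta>'" "z \<notin> cfv D"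
    using ex_new_if_finite infinite_UNIV_nat by (metis UnCI)
  define D' where "D' = cren (id(y := z)) D"
  have D': "cpi y B D = cpi z B D'" "csub M y B D = csub M z B D'"
    using cpi_alpha[OF z(3)] csub_alpha[OF z(3)] by (simp_all add: D'_def)
  have zx: "z \<noteq> x" "z \<notin> cfv (tr u)" "z \<notin> cfv A"
    using z(1) subst_env_ctxt(3,4)[OF E] by (auto simp: \<Theta>)
  obtain s1 s2 s3 where R: "(s1, s2, s3) \<in> Rl" and B: "cty Ax Rl \<Theta> B (CSort s1)"
    and D: "cty Ax Rl (\<Theta> @ [(z, B)]) D' (CSort s2)"
    using cty_cpiD[OF pi[unfolded D'(1)] z(1)] .
  have SB: "cty Ax Rl \<Delta>' (S B) (CSort s1)"
    using subst_env_csub_sort[OF E] B unfolding S_def \<Theta> by blast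
  have E2: "subst_env Ax Rl \<Gamma> (tr u) x A (\<Delta> @ [(z, B)]) (\<Delta>' @ [(z, S B)])"
    using subst_env_snoc[OF E _ SB z(2)] cty_cwf[OF D] by (simp add: \<Theta> S_def)
  have SD: "cty Ax Rl (\<Delta>' @ [(z, S B)]) (S D') (CSort s2)"
    using subst_env_csub_sort[OF E2, of D' s2] D by (simp add: \<Theta> S_def)
  have pi': "cty Ax Rl \<Delta>' (cpi z (S B) (S D')) (CSort s3)"
    using cwf_cty_lty.cty_pi[OF SB SD R] .
  show ?case
  proof (intro allI impI)
    fix ts assume "LCons M l = trargs ts"
    then obtain m us where us: "ts = m # us" "M = tr m" "l = trargs us"
      by (auto simp: trargs_eq_LCons)
    let ?m = "tr (psubst x u m)"
    have "cty Ax Rl \<Delta>' ?m (ty B)"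
      using lty_cons.IH(4)[OF \<Theta> E] us(2) by blast
    then have m: "cty Ax Rl \<Delta>' ?m (S B)"
      using subst_env_to_csub[OF E] B unfolding ty_def S_def \<Theta> by blast
    have l: "lty Ax Rl \<Delta>' (S (csub M z B D')) (trargs (map (psubst x u) us)) (S C)"
      using lty_cons.IH(6)[OF \<Theta> E] us(3) D'(2) by simp
    have wf': "cwf Ax Rl \<Delta>'" using E by (simp add: subst_env_def)
    have csub: "cty Ax Rl \<Delta>' (csub ?m z (S B) (S D')) (CSort s2)"
      using cty_csub_sort[OF m _ _ wf', of z "[]"] SD by (simp add: subenv_refl)
    \<comment> \<open>The hypothesis starts the remaining list at a substitution below
      \<open>S\<close>; commuting the two yields the type that \<open>lty_cons\<close> expects for
      the substituted product.\<close>
    have "cconv (S (csub M z B D')) (csub (S M) z (S B) (S D'))"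
      unfolding S_def using zx by (intro csub_csub) auto
    also have "cconv \<dots> (csub ?m z (S B) (S D'))"
      unfolding S_def us(2) by (intro cconv_csub csub_tr cconv_refl)
    finally have "lty Ax Rl \<Delta>' (csub ?m z (S B) (S D')) (trargs (map (psubst x u) us)) (S C)"
      by (rule cwf_cty_lty.lty_conv_left[OF l csub])
    from cwf_cty_lty.lty_cons[OF pi' m this]
    have "lty Ax Rl \<Delta>' (cpi z (S B) (S D')) (trargs (map (psubst x u) ts)) (S C)"
      by (simp add: us(1))
    moreover have "cty Ax Rl \<Delta>' (S (cpi y B D)) (CSort s)"
      using subst_env_csub_sort[OF E] pi unfolding S_def \<Theta> by blast
    moreover have "cconv (cpi z (S B) (S D')) (S (cpi y B D))"
      unfolding D'(1) S_def using zx by (intro cconv_sym[OF cconv_csub_cpi])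
    ultimately show "lty Ax Rl \<Delta>' (S (cpi y B D)) (trargs (map (psubst x u) ts)) (S C)"
      by (rule cwf_cty_lty.lty_conv_left)
  qed
next
  case (lty_conv_right \<Theta> B l C D s)
  note \<Theta> = \<open>\<Theta> = \<Gamma> @ [(x, A)] @ \<Delta>\<close> and E = \<open>subst_env Ax Rl \<Gamma> (tr u) x A \<Delta> \<Delta>'\<close>
  have D: "cty Ax Rl \<Delta>' (S D) (CSort s)"
    using subst_env_csub_sort[OF E] \<open>cty Ax Rl \<Theta> D (CSort s)\<close> unfolding S_def \<Theta> by blast
  show ?case
  proof (intro allI impI)
    fix ts assume "l = trargs ts"
    then have "lty Ax Rl \<Delta>' (S B) (trargs (map (psubst x u) ts)) (S C)"
      using lty_conv_right.IH(2)[OF \<Theta> E] by blast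
    moreover have "cconv (S C) (S D)"
      unfolding S_def using \<open>cconv C D\<close> by (intro cconv_csub cconv_refl)
    ultimately show "lty Ax Rl \<Delta>' (S B) (trargs (map (psubst x u) ts)) (S D)"
      using D cwf_cty_lty.lty_conv_right by metis
  qed
next
  case (lty_conv_left \<Theta> B l C D s)
  note \<Theta> = \<open>\<Theta> = \<Gamma> @ [(x, A)] @ \<Delta>\<close> and E = \<open>subst_env Ax Rl \<Gamma> (tr u) x A \<Delta> \<Delta>'\<close>
  have D: "cty Ax Rl \<Delta>' (S D) (CSort s)"
    using subst_env_csub_sort[OF E] \<open>cty Ax Rl \<Theta> D (CSort s)\<close> unfolding S_def \<Theta> by blast
  show ?case
  proof (intro allI impI)
    fix ts assume "l = trargs ts"
    then have "lty Ax Rl \<Delta>' (S B) (trargs (map (psubst x u) ts)) (S C)"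
      using lty_conv_left.IH(2)[OF \<Theta> E] by blast
    moreover have "cconv (S B) (S D)"
      unfolding S_def using \<open>cconv B D\<close> by (intro cconv_csub cconv_refl)
    ultimately show "lty Ax Rl \<Delta>' (S D) (trargs (map (psubst x u) ts)) (S C)"
      using D cwf_cty_lty.lty_conv_left by metis
  qed
next
  case (lty_cat \<Theta> C l' B l D)
  then show ?case by (simp add: trargs_neq)
next
  case (lty_sub \<Theta> P B y \<Xi> D l C \<Xi>')
  then show ?case by (simp add: trargs_neq)
next
  case (cty_app \<Theta> M B l C)
  note \<Theta> = \<open>\<Theta> = \<Gamma> @ [(x, A)] @ \<Delta>\<close> and E = \<open>subst_env Ax Rl \<Gamma> (tr u) x A \<Delta> \<Delta>'\<close>
  have l: "lty Ax Rl \<Theta> B l C" using cty_app by blast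
  obtain s s' where B: "cty Ax Rl \<Theta> B (CSort s)" and C: "cty Ax Rl \<Theta> C (CSort s')"
    using type_typable(3)[OF l] by blast
  have "cty Ax Rl \<Delta>' (tr (psubst x u t)) (ty C)" if t: "CApp M l = tr t" for t
  proof -
    obtain h us where us: "t = papps h us" "M = tr h" "l = trargs us"
      using tr_eq_CApp[OF t[symmetric]] .
    have "cty Ax Rl \<Delta>' (tr (psubst x u h)) (ty B)"
      using cty_app.IH(2)[OF \<Theta> E] us(2) by blast
    then have "cty Ax Rl \<Delta>' (tr (psubst x u h)) (S B)"
      using subst_env_to_csub[OF E] B unfolding ty_def S_def \<Theta> by blast
    moreover have "lty Ax Rl \<Delta>' (S B) (trargs (map (psubst x u) us)) (S C)"
      using cty_app.IH(4)[OF \<Theta> E] us(3) by blast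
    ultimately have "cty Ax Rl \<Delta>' (tr (psubst x u t)) (S C)"
      unfolding us(1) psubst_papps by (rule cty_papps)
    then show ?thesis
      using subst_env_from_csub[OF E] C unfolding ty_def S_def \<Theta> by blast
  qed
  then show ?case by simp
next
  case (cty_sub \<Theta> P B y \<Xi> M C \<Xi>' C')
  then show ?case by (simp add: tr_neq_csub[THEN not_sym])
qed simp_all

section \<open>Preservation of typing\<close>

text \<open>The substitution lemma for an empty \<open>\<Delta>\<close> and target
  \<open>\<Gamma>\<close>, after renaming \<open>x\<close> away from \<open>\<Gamma>\<close>. Both
  forms of the substituted type are typed, because a conversion between them needs a sort for its
  target.\<close>

lemma tr_subst_typing:
  assumes pi: "cty Ax Rl \<Gamma> (tr (ppi x U T)) (CSort s)" and u: "cty Ax Rl \<Gamma> (tr u) (tr U)"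
  obtains s' where "cty Ax Rl \<Gamma> (tr (psubst x u T)) (CSort s')"
    and "cty Ax Rl \<Gamma> (csub (tr u) x (tr U) (tr T)) (CSort s')"
proof -
  have "finite (fst ` set \<Gamma> \<union> pfv T)" by (simp add: finite_pfv)
  then obtain y where y: "y \<notin> fst ` set \<Gamma>" "y \<notin> pfv T"
    using ex_new_if_finite infinite_UNIV_nat by blast
  define T' where "T' = pren (id(x := y)) T"
  have T': "ppi x U T = ppi y U T'" "psubst x u T = psubst y u T'"
    using ppi_alpha[OF y(2), of U x] psubst_alpha[OF y(2), of u x] by (simp_all add: T'_def)
  have csub: "csub (tr u) x (tr U) (tr T) = csub (tr u) y (tr U) (tr T')"
    using csub_alpha[of y "tr T" "tr u" "tr U" x] y(2) by (simp add: T'_def tr_trl_pren cfv_lfv_tr)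
  obtain s2 where T: "cty Ax Rl (\<Gamma> @ [(y, tr U)]) (tr T') (CSort s2)"
    using cty_cpiD[OF _ y(1)] pi by (metis T'(1) tr_ppi)
  then have E: "subst_env Ax Rl \<Gamma> (tr u) y (tr U) [] \<Gamma>"
    using u by (simp add: subst_env_def subenv_refl cty_cwf[OF T] cty_cwf[OF u])
  have "cty Ax Rl \<Gamma> (tr (psubst y u T')) (CSort s2)"
    using subst_typing(2)[OF T _ E] by auto
  moreover have "cty Ax Rl \<Gamma> (csub (tr u) y (tr U) (tr T')) (CSort s2)"
    using subst_env_csub_sort[OF E] T by simp
  ultimately show ?thesis using that T' csub by simp
qed

text \<open>A version of \<open>lty_cons\<close> with the implicit substitution that the PTS rules
  use.\<close>

lemma lty_LCons_tr:
  assumes pi: "cty Ax Rl \<Gamma> (tr (ppi x U T)) (CSort s)" and u: "cty Ax Rl \<Gamma> (tr u) (tr U)"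
    and l: "lty Ax Rl \<Gamma> (tr (psubst x u T)) l C"
  shows "lty Ax Rl \<Gamma> (tr (ppi x U T)) (LCons (tr u) l) C"
proof -
  obtain s' where "cty Ax Rl \<Gamma> (csub (tr u) x (tr U) (tr T)) (CSort s')"
    using tr_subst_typing[OF pi u] .
  then have "lty Ax Rl \<Gamma> (csub (tr u) x (tr U) (tr T)) l C"
    using lty_conv_left[OF l] cconv_sym[OF csub_tr] by blast
  then show ?thesis
    using lty_cons[OF _ u] pi by (simp add: tr_ppi)
qed

lemma trenv_simps [simp]:
  "trenv [] = []"
  "trenv (\<Gamma> @ \<Delta>) = trenv \<Gamma> @ trenv \<Delta>"
  "trenv ((x, T) # \<Gamma>) = (x, tr T) # trenv \<Gamma>"
  by (simp_all add: trenv_def)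

lemma dom_trenv [simp]: "fst ` set (trenv \<Gamma>) = fst ` set \<Gamma>"
  by (force simp: trenv_def image_iff)

lemma tr_typing:
  shows "pwf Ax Rl \<Gamma> \<Longrightarrow> cwf Ax Rl (trenv \<Gamma>)"
    and "pty Ax Rl \<Gamma> t T \<Longrightarrow> cty Ax Rl (trenv \<Gamma>) (tr t) (tr T)"
proof (induction rule: pwf_pty.inducts)
  case pwf_empty
  show ?case by (simp add: cwf_empty)
next
  case (pwf_ext \<Gamma> T s x)
  then show ?case using cwf_ext[of Ax Rl "trenv \<Gamma>" "tr T" s x] by simp
next
  case (pty_var \<Gamma> x T)
  have x: "(x, tr T) \<in> set (trenv \<Gamma>)"
    using \<open>(x, T) \<in> set \<Gamma>\<close> by (force simp: trenv_def)
  \<comment> \<open>A variable is translated to \<open>CVar x LNil\<close>, and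
    \<open>lty_nil\<close> asks for a sort of its type.\<close>
  obtain s where "cty Ax Rl (trenv \<Gamma>) (tr T) (CSort s)"
    using cwf_lookup[OF _ x] pty_var by blast
  from cty_var[OF lty_nil[OF this] x] show ?case by simp
next
  case (pty_sort \<Gamma> s s')
  then show ?case using cty_sort[of Ax Rl "trenv \<Gamma>" s s'] by simp
next
  case (pty_pi \<Gamma> U s1 x T s2 s3)
  then show ?case using cty_pi[of Ax Rl "trenv \<Gamma>" "tr U" s1 x "tr T" s2 s3] by (simp add: tr_ppi)
next
  case (pty_lam \<Gamma> x U T s t)
  then show ?case using cty_lam[of Ax Rl "trenv \<Gamma>" x "tr U" "tr T" s "tr t"] by (simp add: tr_ppi tr_plam)
next
  case (pty_app \<Gamma> t x U T u)
  have t: "cty Ax Rl (trenv \<Gamma>) (tr t) (tr (ppi x U T))" and u: "cty Ax Rl (trenv \<Gamma>) (tr u) (tr U)"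
    using pty_app by blast+
  \<comment> \<open>The PTS rule for applications does not record that the product is typable; as it
    is not a sort, \<open>type_typable\<close> recovers this.\<close>
  have "tr (ppi x U T) \<notin> range CSort" by (auto simp: tr_ppi)
  then obtain s where pi: "cty Ax Rl (trenv \<Gamma>) (tr (ppi x U T)) (CSort s)"
    using type_typable(2)[OF t] by blast
  obtain s' where "cty Ax Rl (trenv \<Gamma>) (tr (psubst x u T)) (CSort s')"
    using tr_subst_typing[OF pi u] .
  from lty_LCons_tr[OF pi u lty_nil[OF this]]
  have "lty Ax Rl (trenv \<Gamma>) (tr (ppi x U T)) (trargs [u]) (tr (psubst x u T))" by simp
  from cty_papps[OF t this] show ?case by simp
next
  case (pty_conv \<Gamma> t U V s)
  then show ?case using cty_conv[of Ax Rl "trenv \<Gamma>" "tr t" "tr U" "tr V" s] tr_pconv[of U V] by simp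
qed

section \<open>Iterated products\<close>

lemma psubst_ppis:
  assumes "x \<notin> set xs" "\<forall>y\<in>set xs. y \<notin> pfv u" "length xs = length Ts"
  shows "psubst x u (ppis (zip xs Ts) T) = ppis (zip xs (map (psubst x u) Ts)) (psubst x u T)"
  using assms(3,1,2)
  by (induction xs Ts rule: list_induct2) (auto simp: ppis_def psubst_ppi)

text \<open>Induction on the arguments, with the typing of terms already available. The first
  argument is substituted into the remaining iterated product, whose typability, possibly by another
  sort, comes from \<open>tr_subst_typing\<close>; hence \<open>s\<close> is generalised.\<close>

lemma trargs_typing:
  assumes "length xs = length ts" "length Ts = length ts"
    and "distinct xs" "\<forall>i<length ts. \<forall>j<i. xs ! i \<notin> pfv (ts ! j)"
    and "\<forall>i<length ts. pty Ax Rl \<Gamma> (ts ! i) (psubsts (take i (zip xs ts)) (Ts ! i))"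
    and "cty Ax Rl (trenv \<Gamma>) (tr (ppis (zip xs Ts) T)) (CSort s)"
  shows "lty Ax Rl (trenv \<Gamma>) (tr (ppis (zip xs Ts) T)) (trargs ts) (tr (psubsts (zip xs ts) T))"
  using assms
proof (induction ts arbitrary: xs Ts T s)
  case Nil
  then show ?case using lty_nil by (simp add: ppis_def psubsts_def)
next
  case (Cons u ts)
  obtain x xs' where xs: "xs = x # xs'" using Cons.prems(1) by (cases xs) auto
  obtain U Us where Ts: "Ts = U # Us" using Cons.prems(2) by (cases Ts) auto
  define V where "V = ppis (zip xs' Us) T"
  have pi: "ppis (zip xs Ts) T = ppi x U V"
    by (simp add: xs Ts ppis_def V_def)
  have fresh: "xs' ! i \<notin> pfv u" if "i < length ts" for i
    using Cons.prems(4)[rule_format, of "Suc i" 0] that by (simp add: xs)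
  have "pty Ax Rl \<Gamma> u U"
    using Cons.prems(5)[rule_format, of 0] by (simp add: Ts psubsts_def)
  then have u: "cty Ax Rl (trenv \<Gamma>) (tr u) (tr U)" by (rule tr_typing)
  have pi_typed: "cty Ax Rl (trenv \<Gamma>) (tr (ppi x U V)) (CSort s)"
    using Cons.prems(6) by (simp add: pi)
  obtain s' where s': "cty Ax Rl (trenv \<Gamma>) (tr (psubst x u V)) (CSort s')"
    using tr_subst_typing[OF pi_typed u] .
  have V: "psubst x u V = ppis (zip xs' (map (psubst x u) Us)) (psubst x u T)"
    unfolding V_def
    using Cons.prems fresh by (intro psubst_ppis) (auto simp: xs Ts in_set_conv_nth)
  have "lty Ax Rl (trenv \<Gamma>) (tr (ppis (zip xs' (map (psubst x u) Us)) (psubst x u T))) (trargs ts)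
      (tr (psubsts (zip xs' ts) (psubst x u T)))"
  proof (rule Cons.IH)
    show "\<forall>i<length ts. \<forall>j<i. xs' ! i \<notin> pfv (ts ! j)"
    proof (intro allI impI)
      fix i j assume "i < length ts" "j < i"
      then show "xs' ! i \<notin> pfv (ts ! j)"
        using Cons.prems(4)[rule_format, of "Suc i" "Suc j"] by (simp add: xs)
    qed
    \<comment> \<open>\<open>take (Suc i)\<close> of the longer list substitutes \<open>u\<close>
      for \<open>x\<close> first, which the mapped types have already undergone.\<close>
    show "\<forall>i<length ts. pty Ax Rl \<Gamma> (ts ! i)
        (psubsts (take i (zip xs' ts)) (map (psubst x u) Us ! i))"
    proof (intro allI impI)
      fix i assume "i < length ts"
      then show "pty Ax Rl \<Gamma> (ts ! i) (psubsts (take i (zip xs' ts)) (map (psubst x u) Us ! i))"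
        using Cons.prems(5)[rule_format, of "Suc i"] Cons.prems(2) by (simp add: xs Ts psubsts_def)
    qed
  qed (use Cons.prems s' in \<open>simp_all add: xs Ts V\<close>)
  then have "lty Ax Rl (trenv \<Gamma>) (tr (psubst x u V)) (trargs ts) (tr (psubsts (zip xs' ts) (psubst x u T)))"
    by (simp add: V)
  from lty_LCons_tr[OF pi_typed u this] show ?case
    by (simp add: pi) (simp add: xs psubsts_def)
qed

text \<open>The conditions on \<open>xs\<close> in the second part spell out the variable convention
  for named products: they let each substitution pass below the later binders without
  capture.\<close>

theorem theorem4p3:
  fixes Ax :: "('s \<times> 's) set" and Rl :: "('s \<times> 's \<times> 's) set"
  shows
    "(\<forall>\<Gamma> t T. pty Ax Rl \<Gamma> t T \<longrightarrow> cty Ax Rl (trenv \<Gamma>) (tr t) (tr T))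
   \<and> (\<forall>\<Gamma> n xs Ts ts T s.
        length xs = n \<longrightarrow> length Ts = n \<longrightarrow> length ts = n \<longrightarrow>
        distinct xs \<longrightarrow> (\<forall>i<n. \<forall>j<i. xs ! i \<notin> pfv (ts ! j)) \<longrightarrow>
        (\<forall>i<n. pty Ax Rl \<Gamma> (ts ! i) (psubsts (take i (zip xs ts)) (Ts ! i))) \<longrightarrow>
        cty Ax Rl (trenv \<Gamma>) (tr (ppis (zip xs Ts) T)) (CSort s) \<longrightarrow>
        lty Ax Rl (trenv \<Gamma>) (tr (ppis (zip xs Ts) T)) (trargs ts) (tr (psubsts (zip xs ts) T)))
   \<and> (\<forall>\<Gamma>. pwf Ax Rl \<Gamma> \<longrightarrow> cwf Ax Rl (trenv \<Gamma>))"
proof (intro conjI allI impI)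
  fix \<Gamma> :: "'s penv" and n xs Ts and ts :: "'s pterm list" and T s
  assume "length xs = n" "length Ts = n" "length ts = n" "distinct xs"
    "\<forall>i<n. \<forall>j<i. xs ! i \<notin> pfv (ts ! j)"
    "\<forall>i<n. pty Ax Rl \<Gamma> (ts ! i) (psubsts (take i (zip xs ts)) (Ts ! i))"
    "cty Ax Rl (trenv \<Gamma>) (tr (ppis (zip xs Ts) T)) (CSort s)"
  then show "lty Ax Rl (trenv \<Gamma>) (tr (ppis (zip xs Ts) T)) (trargs ts) (tr (psubsts (zip xs ts) T))"
    by (intro trargs_typing) simp_all
qed (rule tr_typing; assumption)+

end
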